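(* Let $(\mathcal L,\alpha_{\mathcal L})$ be a Hom-Leibniz-Rinehart algebra over $(\mathcal A,\varphi)$ and let $(\mathcal M,\alpha_{\mathcal M})$ be a representation of $\mathcal L$. Then there is a one-to-one correspondence between the equivalence classes of $\mathcal A$-split abelian extensions of $(\mathcal L,\alpha_{\mathcal L})$ by $(\mathcal M,\alpha_{\mathcal M})$ and the cohomology classes in $H^2(\mathcal L,\mathcal M)$.
   Context: Let $\mathbb K$ be a field, $\mathcal A$ an associative commutative $\mathbb K$-algebra and $\varphi:\mathcal A\to\mathcal A$ an algebra homomorphism. A $\varphi$-derivation of $\mathcal A$ is a $\mathbb K$-linear map $\delta$ with $\delta(fg)=\varphi(f)\delta(g)+\varphi(g)\delta(f)$; the set of them is $\mathrm{Der}_\varphi\mathcal A$. A Hom-Leibniz algebra is a $\mathbb K$-vector space $\mathcal L$ with a bilinear bracket $[\cdot,\cdot]$ and a linear map $\alpha_{\mathcal L}$ such that $[\alpha_{\mathcal L}(x),[y,z]]=[[x,y],\alpha_{\mathcal L}(z)]+[\alpha_{\mathcal L}(y),[x,z]]$. Throughout, all Hom-Leibniz algebras are multiplicative and regular: $\alpha_{\mathcal L}$ is bijective and $\alpha_{\mathcal L}[x,y]=[\alpha_{\mathcal L}(x),\alpha_{\mathcal L}(y)]$. A Hom-Leibniz-Rinehart algebra over $(\mathcal A,\varphi)$ is an $\mathcal A$-module $\mathcal L$ with a Hom-Leibniz algebra structure $([\cdot,\cdot],\alpha_{\mathcal L})$ and linear maps (left and right anchors) $\rho^L,\rho^R:\mathcal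 L\to\mathrm{Der}_\varphi\mathcal A$ such that, for $f\in\mathcal A$, $x,y\in\mathcal L$: $\alpha_{\mathcal L}(fx)=\varphi(f)\alpha_{\mathcal L}(x)$; $\rho^L(\alpha_{\mathcal L}(x))(\varphi(f))=\varphi(\rho^L(x)(f))$; $\rho^R(\alpha_{\mathcal L}(x))(\varphi(f))=\varphi(\rho^R(x)(f))$; $\rho^R(\alpha_{\mathcal L}(y))\rho^R(x)(f)=-\rho^R(\alpha_{\mathcal L}(y))\rho^L(x)(f)$; $\rho^L([x,y])(\varphi(f))=\rho^L(\alpha_{\mathcal L}(x))\rho^L(y)(f)-\rho^L(\alpha_{\mathcal L}(y))\rho^L(x)(f)$; $\rho^R([x,y])(\varphi(f))=\rho^L(\alpha_{\mathcal L}(x))\rho^R(y)(f)-\rho^R(\alpha_{\mathcal L}(y))\rho^L(x)(f)$; $[x,fy]=\varphi(f)[x,y]+\rho^L(x)(f)\alpha_{\mathcal L}(y)$; $[fx,y]=\varphi(f)[x,y]-\rho^R(y)(f)\alpha_{\mathcal L}(x)$; $\rho^L(fx)=\varphi(f)\rho^L(x)$; $\rho^R(fx)=\varphi(f)\rho^R(x)$. A homomorphism of Hom-Leibniz-Rinehart algebras over $(\mathcal A,\varphi)$ is an $\mathcal A$-linear map $\Phi$ commuting with the maps $\alpha$, preserving brackets, and satisfying $\rho^L\circ\Phi=\rho^L$, $\rho^R\circ\Phi=\rho^R$. A representation of $\mathcal L$ is an $\mathcal A$-module $\mathcal M$ with a linear bijection $\alpha_{\mathcal M}$ satisfying $\alpha_{\mathcal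 M}(fm)=\varphi(f)\alpha_{\mathcal M}(m)$ and with bilinear maps $\mathcal L\times\mathcal M\to\mathcal M$, $(x,m)\mapsto[x,m]$, and $\mathcal M\times\mathcal L\to\mathcal M$, $(m,x)\mapsto[m,x]$, such that $[\alpha_{\mathcal L}(x),[m,y]]=[[x,m],\alpha_{\mathcal L}(y)]+[\alpha_{\mathcal M}(m),[x,y]]$; $[\alpha_{\mathcal M}(m),[x,y]]=[[m,x],\alpha_{\mathcal L}(y)]+[\alpha_{\mathcal L}(x),[m,y]]$; $[\alpha_{\mathcal L}(x),[y,m]]=[[x,y],\alpha_{\mathcal M}(m)]+[\alpha_{\mathcal L}(y),[x,m]]$; $\alpha_{\mathcal M}[x,m]=[\alpha_{\mathcal L}(x),\alpha_{\mathcal M}(m)]$; $\alpha_{\mathcal M}[m,x]=[\alpha_{\mathcal M}(m),\alpha_{\mathcal L}(x)]$; $[fx,m]=\varphi(f)[x,m]$; $[m,fx]=\varphi(f)[m,x]$; $[x,fm]=\varphi(f)[x,m]+\rho^L(x)(f)\alpha_{\mathcal M}(m)$; $[fm,x]=\varphi(f)[m,x]-\rho^R(x)(f)\alpha_{\mathcal M}(m)$. Cohomology. Consider the space of $(\mathcal A,\varphi)$-modules $C^*(\mathcal L,\mathcal M)=\oplus_{n\ge0}C^n(\mathcal L,\mathcal M)$, where $C^n(\mathcal L,\mathcal M)\subseteq\mathrm{Hom}(\otimes^n\mathcal L,\mathcal M)$ consists of the elements $\omega$ satisfying $\omega(\alpha_{\mathcal L}(x_1),\dots,\alpha_{\mathcal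 L}(x_n))=\alpha_{\mathcal M}(\omega(x_1,\dots,x_n))$ for all $x_i\in\mathcal L$. The coboundary $\delta:C^n(\mathcal L,\mathcal M)\to C^{n+1}(\mathcal L,\mathcal M)$ is $$(\delta\omega)(x_1,\dots,x_{n+1})=\sum_{i=1}^n(-1)^{i+1}[\alpha_{\mathcal L}^{n-1}(x_i),\omega(x_1,\dots,\widehat{x_i},\dots,x_{n+1})]+(-1)^{n+1}[\omega(x_1,\dots,x_n),\alpha_{\mathcal L}^{n-1}(x_{n+1})]$$ $$+\sum_{1\le i<j\le n+1}(-1)^i\omega(\alpha_{\mathcal L}(x_1),\dots,\widehat{\alpha_{\mathcal L}(x_i)},\dots,\alpha_{\mathcal L}(x_{j-1}),[x_i,x_j],\alpha_{\mathcal L}(x_{j+1}),\dots,\alpha_{\mathcal L}(x_{n+1})).$$ $H^2(\mathcal L,\mathcal M)$ is the second cohomology of this complex, i.e. $\{h\in C^2(\mathcal L,\mathcal M):\delta h=0\}/\delta(C^1(\mathcal L,\mathcal M))$. Extensions. An abelian extension of $\mathcal L$ by $\mathcal M$ is a short exact sequence $0\to\mathcal M\xrightarrow{i}\mathcal L'\xrightarrow{\pi}\mathcal L\to0$ where $\mathcal L'$ is a Hom-Leibniz-Rinehart algebra over $(\mathcal A,\varphi)$, $\pi$ is a homomorphism of Hom-Leibniz-Rinehart algebras, $i$ is $\mathcal A$-linear with $\alpha_{\mathcal L'}\circ i=i\circ\alpha_{\mathcal M}$, and $[i(m),x]=i([m,\pi(x)])$, $[x,i(m)]=i([\pi(x),m])$,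 $[i(m),i(n)]=0=[i(n),i(m)]$ for all $m,n\in\mathcal M$, $x\in\mathcal L'$. It is $\mathcal A$-split if it splits as a sequence of $\mathcal A$-modules, i.e. there is an $\mathcal A$-linear map $\tau:\mathcal L\to\mathcal L'$ with $\pi\circ\tau=\mathrm{id}$. Two such extensions are equivalent if there is an isomorphism of Hom-Leibniz-Rinehart algebras $\mathcal L'\to\mathcal L''$ inducing the identity on $\mathcal M$ and on $\mathcal L$.
   Formalization: Corrected: the splitting τ must also commute with the maps α (with A-linear τ alone the claim is false), and cochains in C^n satisfy ω(…,f x_i,…)=φ^{n-1}(f)ω(…) rather than mere K-multilinearity; A, its modules and φ are taken unital. *)

theory Defs
  imports "HOL-Algebra.Module" "HOL-Algebra.Coset" "HOL-Library.FuncSet"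
begin

text \<open>
  Records extend the module record of HOL-Algebra, so the multiplicative fields of a module
  (\<^const>\<open>mult\<close>, \<^const>\<open>one\<close>) carry no information; all conditions are relative
  to carriers. \<open>A\<close> is a unital algebra over \<open>K\<close>, as in HOL-Algebra, and an \<open>A\<close>-module is a
  \<open>K\<close>-vector space by restriction of scalars along \<open>c \<mapsto> c \<cdot> 1\<close>.
\<close>

definition scal ::
    "('k, 'a, 'r) module_scheme \<Rightarrow> _" where
  "scal A V c v = (c \<odot>\<^bsub>A\<^esub> \<one>\<^bsub>A\<^esub>) \<odot>\<^bsub>V\<^esub> v"

definition additive_map ::
    "('v, 'r) ring_scheme \<Rightarrow> ('w, 's) ring_scheme \<Rightarrow> ('v \<Rightarrow> 'w) \<Rightarrow> bool" where
  "additive_map V W T \<longleftrightarrow> T \<in> carrier V \<rightarrow> carrier W \<and>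
     (\<forall>x\<in>carrier V. \<forall>y\<in>carrier V. T (x \<oplus>\<^bsub>V\<^esub> y) = T x \<oplus>\<^bsub>W\<^esub> T y)"

definition K_linear where
  "K_linear K A V W T \<longleftrightarrow> additive_map V W T \<and>
     (\<forall>c\<in>carrier K. \<forall>x\<in>carrier V. T (scal A V c x) = scal A W c (T x))"

definition K_bilinear where
  "K_bilinear K A U V W B \<longleftrightarrow>
     (\<forall>x\<in>carrier U. K_linear K A V W (\<lambda>y. B x y)) \<and>
     (\<forall>y\<in>carrier V. K_linear K A U W (\<lambda>x. B x y))"

definition A_linear where
  "A_linear A V W T \<longleftrightarrow> additive_map V W T \<and>
     (\<forall>f\<in>carrier A. \<forall>x\<in>carrier V. T (f \<odot>\<^bsub>V\<^esub> x) = f \<odot>\<^bsub>W\<^esub> T x)"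

locale twisted_algebra = field K + algebra K A
  for K :: "'k ring" (structure) and A :: "('k, 'a) module" (structure) +
  fixes \<phi> :: "'a \<Rightarrow> 'a"
  assumes phi_hom: "\<phi> \<in> ring_hom A A"
    and phi_smult: "\<lbrakk>c \<in> carrier K; f \<in> carrier A\<rbrakk> \<Longrightarrow> \<phi> (c \<odot>\<^bsub>A\<^esub> f) = c \<odot>\<^bsub>A\<^esub> \<phi> f"

definition phi_derivations ::
    "'k ring \<Rightarrow> ('k, 'a) module \<Rightarrow> ('a \<Rightarrow> 'a) \<Rightarrow> ('a \<Rightarrow> 'a) set" where
  "phi_derivations K A \<phi> = {d. additive_map A A d \<and>
     (\<forall>c\<in>carrier K. \<forall>f\<in>carrier A. d (c \<odot>\<^bsub>A\<^esub> f) = c \<odot>\<^bsub>A\<^esub> d f) \<and>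
     (\<forall>f\<in>carrier A. \<forall>g\<in>carrier A.
        d (f \<otimes>\<^bsub>A\<^esub> g) = \<phi> f \<otimes>\<^bsub>A\<^esub> d g \<oplus>\<^bsub>A\<^esub> \<phi> g \<otimes>\<^bsub>A\<^esub> d f)}"

section \<open>$(A,\varphi)$-modules, Hom-Leibniz-Rinehart algebras and representations\<close>

record ('a, 'v) twisted_module = "('a, 'v) module" +
  twist :: "'v \<Rightarrow> 'v" (\<open>\<alpha>\<index>\<close>)

locale hom_module = twisted_algebra K A \<phi> + V: module A V
  for K :: "'k ring" and A :: "('k, 'a) module" and \<phi>
    and V :: "('a, 'v, 'r) twisted_module_scheme" (structure) +
  assumes twist_linear: "K_linear K A V V \<alpha>"
    and twist_bij: "bij_betw \<alpha> (carrier V) (carrier V)"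
    and twist_smult: "\<lbrakk>f \<in> carrier A; x \<in> carrier V\<rbrakk> \<Longrightarrow> \<alpha> (f \<odot>\<^bsub>V\<^esub> x) = \<phi> f \<odot>\<^bsub>V\<^esub> \<alpha> x"

definition hom_module_map where
  "hom_module_map A V W T \<longleftrightarrow>
     A_linear A V W T \<and> (\<forall>x\<in>carrier V. T (\<alpha>\<^bsub>V\<^esub> x) = \<alpha>\<^bsub>W\<^esub> (T x))"

record ('a, 'l) hlr = "('a, 'l) twisted_module" +
  bracket :: "'l \<Rightarrow> 'l \<Rightarrow> 'l" (\<open>\<langle>_,/ _\<rangle>\<index>\<close>)
  lanchor :: "'l \<Rightarrow> 'a \<Rightarrow> 'a" (\<open>\<rho>\<^sub>L\<index>\<close>)
  ranchor :: "'l \<Rightarrow> 'a \<Rightarrow> 'a" (\<open>\<rho>\<^sub>R\<index>\<close>)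

locale hom_leibniz_rinehart = hom_module K A \<phi> L
  for K :: "'k ring" and A :: "('k, 'a) module" and \<phi> :: "'a \<Rightarrow> 'a"
    and L :: "('a, 'l) hlr" (structure) +
  assumes bracket_bilinear: "K_bilinear K A L L L (bracket L)"
    and hom_leibniz: "\<lbrakk>x \<in> carrier L; y \<in> carrier L; z \<in> carrier L\<rbrakk> \<Longrightarrow>
      \<langle>\<alpha> x, \<langle>y, z\<rangle>\<rangle> = \<langle>\<langle>x, y\<rangle>, \<alpha> z\<rangle> \<oplus> \<langle>\<alpha> y, \<langle>x, z\<rangle>\<rangle>"
    and twist_bracket: "\<lbrakk>x \<in> carrier L; y \<in> carrier L\<rbrakk> \<Longrightarrow> \<alpha> \<langle>x, y\<rangle> = \<langle>\<alpha> x, \<alpha> y\<rangle>"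
    and lanchor_der: "x \<in> carrier L \<Longrightarrow> \<rho>\<^sub>L x \<in> phi_derivations K A \<phi>"
    and ranchor_der: "x \<in> carrier L \<Longrightarrow> \<rho>\<^sub>R x \<in> phi_derivations K A \<phi>"
    and lanchor_add: "\<lbrakk>x \<in> carrier L; y \<in> carrier L; f \<in> carrier A\<rbrakk> \<Longrightarrow>
      \<rho>\<^sub>L (x \<oplus> y) f = \<rho>\<^sub>L x f \<oplus>\<^bsub>A\<^esub> \<rho>\<^sub>L y f"
    and ranchor_add: "\<lbrakk>x \<in> carrier L; y \<in> carrier L; f \<in> carrier A\<rbrakk> \<Longrightarrow>
      \<rho>\<^sub>R (x \<oplus> y) f = \<rho>\<^sub>R x f \<oplus>\<^bsub>A\<^esub> \<rho>\<^sub>R y f"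
    and lanchor_scal: "\<lbrakk>c \<in> carrier K; x \<in> carrier L; f \<in> carrier A\<rbrakk> \<Longrightarrow>
      \<rho>\<^sub>L (scal A L c x) f = c \<odot>\<^bsub>A\<^esub> \<rho>\<^sub>L x f"
    and ranchor_scal: "\<lbrakk>c \<in> carrier K; x \<in> carrier L; f \<in> carrier A\<rbrakk> \<Longrightarrow>
      \<rho>\<^sub>R (scal A L c x) f = c \<odot>\<^bsub>A\<^esub> \<rho>\<^sub>R x f"
    and lanchor_twist: "\<lbrakk>x \<in> carrier L; f \<in> carrier A\<rbrakk> \<Longrightarrow> \<rho>\<^sub>L (\<alpha> x) (\<phi> f) = \<phi> (\<rho>\<^sub>L x f)"
    and ranchor_twist: "\<lbrakk>x \<in> carrier L; f \<in> carrier A\<rbrakk> \<Longrightarrow> \<rho>\<^sub>R (\<alpha> x) (\<phi> f) = \<phi> (\<rho>\<^sub>R x f)"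
    and ranchor_ranchor: "\<lbrakk>x \<in> carrier L; y \<in> carrier L; f \<in> carrier A\<rbrakk> \<Longrightarrow>
      \<rho>\<^sub>R (\<alpha> y) (\<rho>\<^sub>R x f) = \<ominus>\<^bsub>A\<^esub> \<rho>\<^sub>R (\<alpha> y) (\<rho>\<^sub>L x f)"
    and lanchor_bracket: "\<lbrakk>x \<in> carrier L; y \<in> carrier L; f \<in> carrier A\<rbrakk> \<Longrightarrow>
      \<rho>\<^sub>L \<langle>x, y\<rangle> (\<phi> f) = \<rho>\<^sub>L (\<alpha> x) (\<rho>\<^sub>L y f) \<ominus>\<^bsub>A\<^esub> \<rho>\<^sub>L (\<alpha> y) (\<rho>\<^sub>L x f)"
    and ranchor_bracket: "\<lbrakk>x \<in> carrier L; y \<in> carrier L; f \<in> carrier A\<rbrakk> \<Longrightarrow>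
      \<rho>\<^sub>R \<langle>x, y\<rangle> (\<phi> f) = \<rho>\<^sub>L (\<alpha> x) (\<rho>\<^sub>R y f) \<ominus>\<^bsub>A\<^esub> \<rho>\<^sub>R (\<alpha> y) (\<rho>\<^sub>L x f)"
    and bracket_smult_right: "\<lbrakk>x \<in> carrier L; y \<in> carrier L; f \<in> carrier A\<rbrakk> \<Longrightarrow>
      \<langle>x, f \<odot>\<^bsub>L\<^esub> y\<rangle> = \<phi> f \<odot>\<^bsub>L\<^esub> \<langle>x, y\<rangle> \<oplus> \<rho>\<^sub>L x f \<odot>\<^bsub>L\<^esub> \<alpha> y"
    and bracket_smult_left: "\<lbrakk>x \<in> carrier L; y \<in> carrier L; f \<in> carrier A\<rbrakk> \<Longrightarrow>
      \<langle>f \<odot>\<^bsub>L\<^esub> x, y\<rangle> = \<phi> f \<odot>\<^bsub>L\<^esub> \<langle>x, y\<rangle> \<ominus>\<^bsub>L\<^esub> \<rho>\<^sub>R y f \<odot>\<^bsub>L\<^esub> \<alpha> x"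
    and lanchor_smult: "\<lbrakk>x \<in> carrier L; f \<in> carrier A; g \<in> carrier A\<rbrakk> \<Longrightarrow>
      \<rho>\<^sub>L (f \<odot>\<^bsub>L\<^esub> x) g = \<phi> f \<otimes>\<^bsub>A\<^esub> \<rho>\<^sub>L x g"
    and ranchor_smult: "\<lbrakk>x \<in> carrier L; f \<in> carrier A; g \<in> carrier A\<rbrakk> \<Longrightarrow>
      \<rho>\<^sub>R (f \<odot>\<^bsub>L\<^esub> x) g = \<phi> f \<otimes>\<^bsub>A\<^esub> \<rho>\<^sub>R x g"

definition hlr_map ::
    "('k, 'a) module \<Rightarrow> ('a, 'l) hlr \<Rightarrow> ('a, 'e) hlr \<Rightarrow> ('l \<Rightarrow> 'e) \<Rightarrow> bool" where
  "hlr_map A L L' \<Phi> \<longleftrightarrow> hom_module_map A L L' \<Phi> \<and>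
     (\<forall>x\<in>carrier L. \<forall>y\<in>carrier L. \<Phi> \<langle>x, y\<rangle>\<^bsub>L\<^esub> = \<langle>\<Phi> x, \<Phi> y\<rangle>\<^bsub>L'\<^esub>) \<and>
     (\<forall>x\<in>carrier L. \<forall>f\<in>carrier A.
        lanchor L' (\<Phi> x) f = lanchor L x f \<and> ranchor L' (\<Phi> x) f = ranchor L x f)"

text \<open>The two actions \<open>x \<triangleright> m\<close> and \<open>m \<triangleleft> x\<close> are the mixed brackets $[x,m]$ and $[m,x]$.\<close>

record ('a, 'l, 'm) hlr_rep = "('a, 'm) twisted_module" +
  lact :: "'l \<Rightarrow> 'm \<Rightarrow> 'm" (infixl \<open>\<triangleright>\<index>\<close> 70)
  ract :: "'m \<Rightarrow> 'l \<Rightarrow> 'm" (infixl \<open>\<triangleleft>\<index>\<close> 70)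

locale hlr_representation = L: hom_leibniz_rinehart K A \<phi> L + M: hom_module K A \<phi> M
  for K :: "'k ring" and A :: "('k, 'a) module" and \<phi> :: "'a \<Rightarrow> 'a"
    and L :: "('a, 'l) hlr" and M :: "('a, 'l, 'm) hlr_rep" (structure) +
  assumes lact_bilinear: "K_bilinear K A L M M (lact M)"
    and ract_bilinear: "K_bilinear K A M L M (ract M)"
    and rep_LML: "\<lbrakk>x \<in> carrier L; y \<in> carrier L; m \<in> carrier M\<rbrakk> \<Longrightarrow>
      \<alpha>\<^bsub>L\<^esub> x \<triangleright> (m \<triangleleft> y) = (x \<triangleright> m) \<triangleleft> \<alpha>\<^bsub>L\<^esub> y \<oplus> \<alpha> m \<triangleleft> \<langle>x, y\<rangle>\<^bsub>L\<^esub>"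
    and rep_MLL: "\<lbrakk>x \<in> carrier L; y \<in> carrier L; m \<in> carrier M\<rbrakk> \<Longrightarrow>
      \<alpha> m \<triangleleft> \<langle>x, y\<rangle>\<^bsub>L\<^esub> = (m \<triangleleft> x) \<triangleleft> \<alpha>\<^bsub>L\<^esub> y \<oplus> \<alpha>\<^bsub>L\<^esub> x \<triangleright> (m \<triangleleft> y)"
    and rep_LLM: "\<lbrakk>x \<in> carrier L; y \<in> carrier L; m \<in> carrier M\<rbrakk> \<Longrightarrow>
      \<alpha>\<^bsub>L\<^esub> x \<triangleright> (y \<triangleright> m) = \<langle>x, y\<rangle>\<^bsub>L\<^esub> \<triangleright> \<alpha> m \<oplus> \<alpha>\<^bsub>L\<^esub> y \<triangleright> (x \<triangleright> m)"
    and twist_lact: "\<lbrakk>x \<in> carrier L; m \<in> carrier M\<rbrakk> \<Longrightarrow> \<alpha> (x \<triangleright> m) = \<alpha>\<^bsub>L\<^esub> x \<triangleright> \<alpha> m"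
    and twist_ract: "\<lbrakk>x \<in> carrier L; m \<in> carrier M\<rbrakk> \<Longrightarrow> \<alpha> (m \<triangleleft> x) = \<alpha> m \<triangleleft> \<alpha>\<^bsub>L\<^esub> x"
    and smult_lact: "\<lbrakk>x \<in> carrier L; m \<in> carrier M; f \<in> carrier A\<rbrakk> \<Longrightarrow>
      (f \<odot>\<^bsub>L\<^esub> x) \<triangleright> m = \<phi> f \<odot>\<^bsub>M\<^esub> (x \<triangleright> m)"
    and ract_smult: "\<lbrakk>x \<in> carrier L; m \<in> carrier M; f \<in> carrier A\<rbrakk> \<Longrightarrow>
      m \<triangleleft> (f \<odot>\<^bsub>L\<^esub> x) = \<phi> f \<odot>\<^bsub>M\<^esub> (m \<triangleleft> x)"
    and lact_smult: "\<lbrakk>x \<in> carrier L; m \<in> carrier M; f \<in> carrier A\<rbrakk> \<Longrightarrow>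
      x \<triangleright> (f \<odot>\<^bsub>M\<^esub> m) = \<phi> f \<odot>\<^bsub>M\<^esub> (x \<triangleright> m) \<oplus> lanchor L x f \<odot>\<^bsub>M\<^esub> \<alpha> m"
    and smult_ract: "\<lbrakk>x \<in> carrier L; m \<in> carrier M; f \<in> carrier A\<rbrakk> \<Longrightarrow>
      (f \<odot>\<^bsub>M\<^esub> m) \<triangleleft> x = \<phi> f \<odot>\<^bsub>M\<^esub> (m \<triangleleft> x) \<ominus>\<^bsub>M\<^esub> ranchor L x f \<odot>\<^bsub>M\<^esub> \<alpha> m"

section \<open>Cohomology\<close>

text \<open>
  $n$-tuples are lists of length $n$, indexed from 0; cochains are functions on lists that are
  \<^const>\<open>undefined\<close> outside the $n$-tuples over the carrier.
\<close>

definition tuples :: "('l, 'r) ring_scheme \<Rightarrow> nat \<Rightarrow> 'l list set" where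
  "tuples L n = {xs. length xs = n \<and> set xs \<subseteq> carrier L}"

text \<open>
  The homomorphisms of $C^n$ are those of $(A,\varphi)$-modules: in each slot $f$ comes out as
  $\varphi^{n-1}(f)$, which is what \<open>\<delta>\<close> produces on $C^1$ (the brackets bring out $\varphi(f)$).
  For $n = 1$ this is $A$-linearity; it contains $K$-multilinearity since $\varphi$ fixes $K$.
\<close>

definition cochains ::
    "('k, 'a) module \<Rightarrow> ('a \<Rightarrow> 'a) \<Rightarrow> ('a, 'l) hlr \<Rightarrow> ('a, 'l, 'm) hlr_rep \<Rightarrow> nat \<Rightarrow>
     ('l list \<Rightarrow> 'm) set" where
  "cochains A \<phi> L M n = {\<omega> \<in> tuples L n \<rightarrow>\<^sub>E carrier M.
     (\<forall>xs\<in>tuples L n. \<forall>i<n. \<forall>x\<in>carrier L. \<forall>y\<in>carrier L.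
        \<omega> (xs[i := x \<oplus>\<^bsub>L\<^esub> y]) = \<omega> (xs[i := x]) \<oplus>\<^bsub>M\<^esub> \<omega> (xs[i := y])) \<and>
     (\<forall>xs\<in>tuples L n. \<forall>i<n. \<forall>f\<in>carrier A. \<forall>x\<in>carrier L.
        \<omega> (xs[i := f \<odot>\<^bsub>L\<^esub> x]) = (\<phi> ^^ (n - 1)) f \<odot>\<^bsub>M\<^esub> \<omega> (xs[i := x])) \<and>
     (\<forall>xs\<in>tuples L n. \<omega> (map \<alpha>\<^bsub>L\<^esub> xs) = \<alpha>\<^bsub>M\<^esub> (\<omega> xs))}"

definition cochain_group ::
    "('k, 'a) module \<Rightarrow> ('a \<Rightarrow> 'a) \<Rightarrow> ('a, 'l) hlr \<Rightarrow> ('a, 'l, 'm) hlr_rep \<Rightarrow> nat \<Rightarrow>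
     ('l list \<Rightarrow> 'm) monoid" where
  "cochain_group A \<phi> L M n =
     \<lparr>carrier = cochains A \<phi> L M n,
      mult = (\<lambda>\<omega> \<eta>. \<lambda>xs\<in>tuples L n. \<omega> xs \<oplus>\<^bsub>M\<^esub> \<eta> xs),
      one = (\<lambda>xs\<in>tuples L n. \<zero>\<^bsub>M\<^esub>)\<rparr>"

definition omit :: "nat \<Rightarrow> 'l list \<Rightarrow> 'l list" where
  "omit i xs = take i xs @ drop (Suc i) xs"

definition alt :: "('m, 'r) ring_scheme \<Rightarrow> nat \<Rightarrow> 'm \<Rightarrow> 'm" where
  "alt M k v = (if even k then v else \<ominus>\<^bsub>M\<^esub> v)"

text \<open>$\alpha_L^{n-1}$, including the exponent $-1$.\<close>

definition twist_pred :: "('a, 'l) hlr \<Rightarrow> nat \<Rightarrow> 'l \<Rightarrow> 'l" where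
  "twist_pred L n =
     (if n = 0 then inv_into (carrier L) \<alpha>\<^bsub>L\<^esub> else \<alpha>\<^bsub>L\<^esub> ^^ (n - 1))"

text \<open>
  Indices are shifted by one: the list positions $i,j$ below are the $i+1,j+1$ of the usual formula,
  so that the three signs are $(-1)^{(i+1)+1}$, $(-1)^{n+1}$ and $(-1)^{i+1}$.
\<close>

definition coboundary ::
    "('a, 'l) hlr \<Rightarrow> ('a, 'l, 'm) hlr_rep \<Rightarrow> nat \<Rightarrow> ('l list \<Rightarrow> 'm) \<Rightarrow> 'l list \<Rightarrow> 'm" where
  "coboundary L M n \<omega> = (\<lambda>xs\<in>tuples L (Suc n).
     (\<Oplus>\<^bsub>M\<^esub>i\<in>{..<n}. alt M i (twist_pred L n (xs ! i) \<triangleright>\<^bsub>M\<^esub> \<omega> (omit i xs)))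
     \<oplus>\<^bsub>M\<^esub> alt M (n + 1) (\<omega> (take n xs) \<triangleleft>\<^bsub>M\<^esub> twist_pred L n (xs ! n))
     \<oplus>\<^bsub>M\<^esub> (\<Oplus>\<^bsub>M\<^esub>j\<in>{..n}. \<Oplus>\<^bsub>M\<^esub>i\<in>{..<j}.
           alt M (i + 1) (\<omega> (omit i ((map \<alpha>\<^bsub>L\<^esub> xs)[j := \<langle>xs ! i, xs ! j\<rangle>\<^bsub>L\<^esub>])))))"

definition cocycles ::
    "('k, 'a) module \<Rightarrow> ('a \<Rightarrow> 'a) \<Rightarrow> ('a, 'l) hlr \<Rightarrow> ('a, 'l, 'm) hlr_rep \<Rightarrow> nat \<Rightarrow>
     ('l list \<Rightarrow> 'm) set" where
  "cocycles A \<phi> L M n =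
     {\<omega> \<in> cochains A \<phi> L M n. \<forall>xs\<in>tuples L (Suc n). coboundary L M n \<omega> xs = \<zero>\<^bsub>M\<^esub>}"

definition H2 ::
    "('k, 'a) module \<Rightarrow> ('a \<Rightarrow> 'a) \<Rightarrow> ('a, 'l) hlr \<Rightarrow> ('a, 'l, 'm) hlr_rep \<Rightarrow>
     ('l list \<Rightarrow> 'm) set monoid" where
  "H2 A \<phi> L M =
     (cochain_group A \<phi> L M 2)\<lparr>carrier := cocycles A \<phi> L M 2\<rparr>
       Mod (coboundary L M 1 ` cochains A \<phi> L M 1)"

section \<open>Abelian extensions\<close>

record ('a, 'l, 'm, 'e) extension =
  total :: "('a, 'e) hlr"
  incl :: "'m \<Rightarrow> 'e"
  proj :: "'e \<Rightarrow> 'l"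

definition abelian_extension ::
    "'k ring \<Rightarrow> ('k, 'a) module \<Rightarrow> ('a \<Rightarrow> 'a) \<Rightarrow> ('a, 'l) hlr \<Rightarrow> ('a, 'l, 'm) hlr_rep \<Rightarrow>
     ('a, 'l, 'm, 'e) extension \<Rightarrow> bool" where
  "abelian_extension K A \<phi> L M E \<longleftrightarrow>
     hom_leibniz_rinehart K A \<phi> (total E) \<and>
     hlr_map A (total E) L (proj E) \<and>
     hom_module_map A M (total E) (incl E) \<and>
     inj_on (incl E) (carrier M) \<and>
     incl E ` carrier M = {x \<in> carrier (total E). proj E x = \<zero>\<^bsub>L\<^esub>} \<and>
     proj E ` carrier (total E) = carrier L \<and>
     (\<forall>m\<in>carrier M. \<forall>x\<in>carrier (total E).
        \<langle>incl E m, x\<rangle>\<^bsub>total E\<^esub> = incl E (m \<triangleleft>\<^bsub>M\<^esub> proj E x) \<and>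
        \<langle>x, incl E m\<rangle>\<^bsub>total E\<^esub> = incl E (proj E x \<triangleright>\<^bsub>M\<^esub> m)) \<and>
     (\<forall>m\<in>carrier M. \<forall>n\<in>carrier M. \<langle>incl E m, incl E n\<rangle>\<^bsub>total E\<^esub> = \<zero>\<^bsub>total E\<^esub>)"

text \<open>
  The splitting takes place in the category of $(A,\varphi)$-modules: the section commutes with the
  twists. A merely $A$-linear section would leave the class of $\alpha_{L'}$ as an extension of
  $\alpha_L$ by $\alpha_M$ undetermined, and that class is not seen by $H^2(L,M)$.
\<close>

definition A_split ::
    "('k, 'a) module \<Rightarrow> ('a, 'l) hlr \<Rightarrow> ('a, 'l, 'm, 'e) extension \<Rightarrow> bool" where
  "A_split A L E \<longleftrightarrow>
     (\<exists>\<tau>. hom_module_map A L (total E) \<tau> \<and> (\<forall>x\<in>carrier L. proj E (\<tau> x) = x))"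

definition A_split_extensions ::
    "'k ring \<Rightarrow> ('k, 'a) module \<Rightarrow> ('a \<Rightarrow> 'a) \<Rightarrow> ('a, 'l) hlr \<Rightarrow> ('a, 'l, 'm) hlr_rep \<Rightarrow>
     ('a, 'l, 'm, 'e) extension set" where
  "A_split_extensions K A \<phi> L M = {E. abelian_extension K A \<phi> L M E \<and> A_split A L E}"

definition equivalent_extensions ::
    "('k, 'a) module \<Rightarrow> ('a, 'l, 'm) hlr_rep \<Rightarrow>
     ('a, 'l, 'm, 'e) extension \<Rightarrow> ('a, 'l, 'm, 'e) extension \<Rightarrow> bool" where
  "equivalent_extensions A M E E' \<longleftrightarrow>
     (\<exists>\<Phi>. hlr_map A (total E) (total E') \<Phi> \<and>
          bij_betw \<Phi> (carrier (total E)) (carrier (total E')) \<and>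
          (\<forall>m\<in>carrier M. \<Phi> (incl E m) = incl E' m) \<and>
          (\<forall>x\<in>carrier (total E). proj E' (\<Phi> x) = proj E x))"

definition extension_equivalence ::
    "'k ring \<Rightarrow> ('k, 'a) module \<Rightarrow> ('a \<Rightarrow> 'a) \<Rightarrow> ('a, 'l) hlr \<Rightarrow> ('a, 'l, 'm) hlr_rep \<Rightarrow>
     (('a, 'l, 'm, 'e) extension \<times> ('a, 'l, 'm, 'e) extension) set" where
  "extension_equivalence K A \<phi> L M =
     {(E, E'). E \<in> A_split_extensions K A \<phi> L M \<and> E' \<in> A_split_extensions K A \<phi> L M \<and>
        equivalent_extensions A M E E'}"

text \<open>
  The underlying sets of the extensions are drawn from the type \<open>'e\<close>; it stands for the class of
  all sets as soon as it has room for \<open>L \<times> M\<close>, to which the underlying set of every split extension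
  is bijective.
\<close>

definition A_split_extension_classes ::
    "'e itself \<Rightarrow> 'k ring \<Rightarrow> ('k, 'a) module \<Rightarrow> ('a \<Rightarrow> 'a) \<Rightarrow> ('a, 'l) hlr \<Rightarrow>
     ('a, 'l, 'm) hlr_rep \<Rightarrow> ('a, 'l, 'm, 'e) extension set set" where
  "A_split_extension_classes TYPE('e) K A \<phi> L M =
     A_split_extensions K A \<phi> L M // extension_equivalence K A \<phi> L M"

end

theory Submission
  imports Defs
begin

text \<open>
  A splitting \<open>\<tau>\<close> of an extension $L'$ identifies $L'$ with $L \oplus M$ through
  $(x,m) \mapsto \tau(x) + i(m)$. In these coordinates everything is determined by $L$ and $M$
  except the bracket, which is
  $$[(x,m),(y,n)] = ([x,y],\; h(x,y) + [x,n] + [m,y]), \qquad i(h(x,y)) = [\tau x,\tau y] - \tau[x,y].$$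
  The axioms of $L'$ hold exactly if $h$ is a 2-cochain with $\delta h = 0$. A second splitting has
  the form \<open>\<tau> + i\<omega>\<close> with \<open>\<omega>\<close> a 1-cochain and replaces $h$ by \<open>h + \<delta>\<omega>\<close>, so the set of all factor
  sets of $L'$ is one coset of the coboundaries. Extensions with a common factor set are equivalent
  because they agree in coordinates.
\<close>

subsection \<open>Cochains in low degrees\<close>

text \<open>The anchors of an extension are pulled back along the projection and its mixed brackets
  are prescribed by the two actions, so only the bracket of two lifted elements is free. Coordinates
  describe the twist because a splitting commutes with the twists; the same fact makes
  \<open>h\<close> commute with them. The invariant attached to an extension is the set of its
  factor sets for all splittings at once: this avoids choosing a splitting and is literally an
  element of the quotient. Two extensions are equivalent exactly if their invariants coincide, so
  extension equivalence is the kernel of a map, which gives both that it is an equivalence relation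
  and that the induced map on classes is injective. For surjectivity an extension has to be built
  inside the type \<open>'e\<close>; the injection \<open>room\<close> supplies its underlying
  set.\<close>

lemma tuples_1: "xs \<in> tuples L 1 \<longleftrightarrow> (\<exists>x\<in>carrier L. xs = [x])"
  by (auto simp: tuples_def length_Suc_conv)

lemma tuples_2: "xs \<in> tuples L 2 \<longleftrightarrow> (\<exists>x\<in>carrier L. \<exists>y\<in>carrier L. xs = [x, y])"
  by (auto simp: tuples_def length_Suc_conv numeral_2_eq_2)

lemma tuples_3:
  "xs \<in> tuples L 3 \<longleftrightarrow>
     (\<exists>x\<in>carrier L. \<exists>y\<in>carrier L. \<exists>z\<in>carrier L. xs = [x, y, z])"
  by (auto simp: tuples_def length_Suc_conv numeral_3_eq_3)

text \<open>The length appears as \<open>Suc 0\<close> because the simplifier rewrites the natural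
  number 1 to that form.\<close>

lemma ball_tuples:
  "(\<forall>xs\<in>tuples L (Suc 0). P xs) \<longleftrightarrow> (\<forall>x\<in>carrier L. P [x])"
  "(\<forall>xs\<in>tuples L 2. P xs) \<longleftrightarrow> (\<forall>x\<in>carrier L. \<forall>y\<in>carrier L. P [x, y])"
  using tuples_1[of _ L] tuples_2[of _ L] by auto

text \<open>The exponent \<open>n - 1\<close> of \<phi> is 0 in degree 1 and 1 in degree 2, so a
  1-cochain is A-linear while a 2-cochain brings out \<phi> f from either slot.\<close>

lemma cochains_1_iff:
  "\<omega> \<in> cochains A \<phi> L M 1 \<longleftrightarrow> \<omega> \<in> tuples L 1 \<rightarrow>\<^sub>E carrier M \<and>
     (\<forall>x\<in>carrier L. \<forall>y\<in>carrier L. \<omega> [x \<oplus>\<^bsub>L\<^esub> y] = \<omega> [x] \<oplus>\<^bsub>M\<^esub> \<omega> [y]) \<and>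
     (\<forall>f\<in>carrier A. \<forall>x\<in>carrier L. \<omega> [f \<odot>\<^bsub>L\<^esub> x] = f \<odot>\<^bsub>M\<^esub> \<omega> [x]) \<and>
     (\<forall>x\<in>carrier L. \<omega> [\<alpha>\<^bsub>L\<^esub> x] = \<alpha>\<^bsub>M\<^esub> (\<omega> [x]))"
  unfolding cochains_def by (auto simp: ball_tuples)

lemma cochains_2_iff:
  "\<omega> \<in> cochains A \<phi> L M 2 \<longleftrightarrow> \<omega> \<in> tuples L 2 \<rightarrow>\<^sub>E carrier M \<and>
     (\<forall>x\<in>carrier L. \<forall>y\<in>carrier L. \<forall>z\<in>carrier L.
        \<omega> [x \<oplus>\<^bsub>L\<^esub> y, z] = \<omega> [x, z] \<oplus>\<^bsub>M\<^esub> \<omega> [y, z] \<and>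
        \<omega> [x, y \<oplus>\<^bsub>L\<^esub> z] = \<omega> [x, y] \<oplus>\<^bsub>M\<^esub> \<omega> [x, z]) \<and>
     (\<forall>f\<in>carrier A. \<forall>x\<in>carrier L. \<forall>y\<in>carrier L.
        \<omega> [f \<odot>\<^bsub>L\<^esub> x, y] = \<phi> f \<odot>\<^bsub>M\<^esub> \<omega> [x, y] \<and>
        \<omega> [x, f \<odot>\<^bsub>L\<^esub> y] = \<phi> f \<odot>\<^bsub>M\<^esub> \<omega> [x, y]) \<and>
     (\<forall>x\<in>carrier L. \<forall>y\<in>carrier L. \<omega> [\<alpha>\<^bsub>L\<^esub> x, \<alpha>\<^bsub>L\<^esub> y] = \<alpha>\<^bsub>M\<^esub> (\<omega> [x, y]))"
  (is "_ \<longleftrightarrow> ?E \<and> ?add \<and> ?smult \<and> ?twist")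
proof -
  have less2: "(\<forall>i<2. P i) \<longleftrightarrow> P 0 \<and> P (1::nat)" for P
    by (auto simp: less_2_cases_iff)
  have "(\<forall>xs\<in>tuples L 2. \<forall>i<2. \<forall>x\<in>carrier L. \<forall>y\<in>carrier L.
        \<omega> (xs[i := x \<oplus>\<^bsub>L\<^esub> y]) = \<omega> (xs[i := x]) \<oplus>\<^bsub>M\<^esub> \<omega> (xs[i := y])) \<longleftrightarrow> ?add"
    unfolding less2 ball_tuples by auto
  moreover have "(\<forall>xs\<in>tuples L 2. \<forall>i<2. \<forall>f\<in>carrier A. \<forall>x\<in>carrier L.
        \<omega> (xs[i := f \<odot>\<^bsub>L\<^esub> x]) = (\<phi> ^^ (2 - 1)) f \<odot>\<^bsub>M\<^esub> \<omega> (xs[i := x])) \<longleftrightarrow> ?smult"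
    unfolding less2 ball_tuples by auto
  moreover have "(\<forall>xs\<in>tuples L 2. \<omega> (map \<alpha>\<^bsub>L\<^esub> xs) = \<alpha>\<^bsub>M\<^esub> (\<omega> xs)) \<longleftrightarrow> ?twist"
    unfolding ball_tuples by auto
  ultimately show ?thesis
    unfolding cochains_def mem_Collect_eq by (simp only:)
qed

section \<open>Computation rules for additive maps, twists, brackets and actions\<close>

lemma additive_map_zero:
  assumes "abelian_group V" "abelian_group W" "additive_map V W T"
  shows "T \<zero>\<^bsub>V\<^esub> = \<zero>\<^bsub>W\<^esub>"
proof -
  interpret V: abelian_group V by fact
  interpret W: abelian_group W by fact
  have T: "T \<zero>\<^bsub>V\<^esub> \<in> carrier W"
    using assms(3) by (auto simp: additive_map_def)
  have "T (\<zero>\<^bsub>V\<^esub> \<oplus>\<^bsub>V\<^esub> \<zero>\<^bsub>V\<^esub>) = T \<zero>\<^bsub>V\<^esub> \<oplus>\<^bsub>W\<^esub> T \<zero>\<^bsub>V\<^esub>"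
    using assms(3) unfolding additive_map_def by blast
  then show ?thesis using T by simp
qed

text \<open>Differences escape normalisation by \<open>a_ac\<close>; this trades an equation
  containing one for an equation between sums.\<close>

lemma (in abelian_group) minus_eq_iff:
  assumes "x \<in> carrier G" "y \<in> carrier G" "z \<in> carrier G"
  shows "x \<ominus> y = z \<longleftrightarrow> x = z \<oplus> y"
proof
  assume "x \<ominus> y = z" then show "x = z \<oplus> y"
    using assms by (auto simp: a_minus_def a_assoc l_neg)
next
  assume "x = z \<oplus> y" then show "x \<ominus> y = z"
    using assms by (auto simp: a_minus_def a_assoc r_neg)
qed

lemma (in abelian_group) minus_add_cancel:
  "\<lbrakk>x \<in> carrier G; y \<in> carrier G\<rbrakk> \<Longrightarrow> x \<ominus> y \<oplus> y = x"
  using minus_eq_iff[of x y "x \<ominus> y"] by simp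

lemma (in twisted_algebra) phi_closed [simp]: "f \<in> carrier A \<Longrightarrow> \<phi> f \<in> carrier A"
  using phi_hom by (auto simp: ring_hom_def)

context hom_module begin

lemma scal_closed [simp]: "\<lbrakk>c \<in> carrier K; x \<in> carrier V\<rbrakk> \<Longrightarrow> scal A V c x \<in> carrier V"
  by (simp add: scal_def)

lemma twist_closed [simp]: "x \<in> carrier V \<Longrightarrow> \<alpha> x \<in> carrier V"
  using twist_bij by (auto simp: bij_betw_def)

lemma twist_add: "\<lbrakk>x \<in> carrier V; y \<in> carrier V\<rbrakk> \<Longrightarrow> \<alpha> (x \<oplus> y) = \<alpha> x \<oplus> \<alpha> y"
  using twist_linear by (auto simp: K_linear_def additive_map_def)

lemma twist_scal: "\<lbrakk>c \<in> carrier K; x \<in> carrier V\<rbrakk> \<Longrightarrow> \<alpha> (scal A V c x) = scal A V c (\<alpha> x)"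
  using twist_linear by (auto simp: K_linear_def)

lemma twist_zero [simp]: "\<alpha> \<zero> = \<zero>"
  using twist_linear additive_map_zero[OF V.abelian_group_axioms V.abelian_group_axioms]
  by (auto simp: K_linear_def)

lemma twist_inj_iff: "\<lbrakk>x \<in> carrier V; y \<in> carrier V\<rbrakk> \<Longrightarrow> \<alpha> x = \<alpha> y \<longleftrightarrow> x = y"
  using twist_bij by (auto simp: bij_betw_def inj_on_def)

end

lemma phi_derivation_closed: "d \<in> phi_derivations K A \<phi> \<Longrightarrow> f \<in> carrier A \<Longrightarrow> d f \<in> carrier A"
  by (auto simp: phi_derivations_def additive_map_def)

text \<open>Stated for an arbitrary bilinear map because four maps take their rules from it: the
  bracket, both actions and a 2-cocycle.\<close>

lemma K_bilinearD:
  assumes "K_bilinear K A U V W B"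
  shows "\<lbrakk>x \<in> carrier U; y \<in> carrier V\<rbrakk> \<Longrightarrow> B x y \<in> carrier W"
    and "\<lbrakk>x \<in> carrier U; y \<in> carrier V; y' \<in> carrier V\<rbrakk> \<Longrightarrow> B x (y \<oplus>\<^bsub>V\<^esub> y') = B x y \<oplus>\<^bsub>W\<^esub> B x y'"
    and "\<lbrakk>x \<in> carrier U; x' \<in> carrier U; y \<in> carrier V\<rbrakk> \<Longrightarrow> B (x \<oplus>\<^bsub>U\<^esub> x') y = B x y \<oplus>\<^bsub>W\<^esub> B x' y"
    and "\<lbrakk>c \<in> carrier K; x \<in> carrier U; y \<in> carrier V\<rbrakk> \<Longrightarrow> B (scal A U c x) y = scal A W c (B x y)"
    and "\<lbrakk>c \<in> carrier K; x \<in> carrier U; y \<in> carrier V\<rbrakk> \<Longrightarrow> B x (scal A V c y) = scal A W c (B x y)"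
  using assms by (auto simp: K_bilinear_def K_linear_def additive_map_def)

lemma K_bilinear_zero:
  assumes "abelian_group U" "abelian_group V" "abelian_group W" "K_bilinear K A U V W B"
  shows "x \<in> carrier U \<Longrightarrow> B x \<zero>\<^bsub>V\<^esub> = \<zero>\<^bsub>W\<^esub>"
    and "y \<in> carrier V \<Longrightarrow> B \<zero>\<^bsub>U\<^esub> y = \<zero>\<^bsub>W\<^esub>"
  using assms additive_map_zero[of V W "B x"] additive_map_zero[of U W "\<lambda>x. B x y"]
  by (auto simp: K_bilinear_def K_linear_def)

context hom_leibniz_rinehart begin

lemmas bracket_closed [simp] = K_bilinearD(1)[OF bracket_bilinear]
lemmas bracket_add_right = K_bilinearD(2)[OF bracket_bilinear]
lemmas bracket_add_left = K_bilinearD(3)[OF bracket_bilinear]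
lemmas bracket_scal_left = K_bilinearD(4)[OF bracket_bilinear]
lemmas bracket_scal_right = K_bilinearD(5)[OF bracket_bilinear]

lemmas bracket_zero [simp] =
  K_bilinear_zero[OF V.abelian_group_axioms V.abelian_group_axioms V.abelian_group_axioms
    bracket_bilinear]

lemma lanchor_closed [simp]: "\<lbrakk>x \<in> carrier L; f \<in> carrier A\<rbrakk> \<Longrightarrow> \<rho>\<^sub>L x f \<in> carrier A"
  using lanchor_der by (rule phi_derivation_closed)

lemma ranchor_closed [simp]: "\<lbrakk>x \<in> carrier L; f \<in> carrier A\<rbrakk> \<Longrightarrow> \<rho>\<^sub>R x f \<in> carrier A"
  using ranchor_der by (rule phi_derivation_closed)

end

context hlr_representation begin

lemmas lact_closed [simp] = K_bilinearD(1)[OF lact_bilinear]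
lemmas lact_add_right = K_bilinearD(2)[OF lact_bilinear]
lemmas lact_add_left = K_bilinearD(3)[OF lact_bilinear]
lemmas lact_scal_left = K_bilinearD(4)[OF lact_bilinear]
lemmas lact_scal_right = K_bilinearD(5)[OF lact_bilinear]
lemmas lact_zero [simp] =
  K_bilinear_zero[OF L.V.abelian_group_axioms M.V.abelian_group_axioms M.V.abelian_group_axioms
    lact_bilinear]
lemmas ract_closed [simp] = K_bilinearD(1)[OF ract_bilinear]
lemmas ract_add_right = K_bilinearD(2)[OF ract_bilinear]
lemmas ract_add_left = K_bilinearD(3)[OF ract_bilinear]
lemmas ract_scal_left = K_bilinearD(4)[OF ract_bilinear]
lemmas ract_scal_right = K_bilinearD(5)[OF ract_bilinear]
lemmas ract_zero [simp] =
  K_bilinear_zero[OF M.V.abelian_group_axioms L.V.abelian_group_axioms M.V.abelian_group_axioms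
    ract_bilinear]

text \<open>For n = 1 the exponent n - 1 of the twist is 0, so the elements act untwisted. The value
  measures how far \<omega> is from being a derivation for the bracket and the two actions.\<close>

lemma coboundary_1:
  assumes \<omega>: "\<omega> \<in> tuples L 1 \<rightarrow> carrier M" and xy: "x \<in> carrier L" "y \<in> carrier L"
  shows "coboundary L M 1 \<omega> [x, y] =
    x \<triangleright> \<omega> [y] \<oplus> \<omega> [x] \<triangleleft> y \<ominus>\<^bsub>M\<^esub> \<omega> [\<langle>x, y\<rangle>\<^bsub>L\<^esub>]"
proof -
  have [simp]: "z \<in> carrier L \<Longrightarrow> \<omega> [z] \<in> carrier M" for z
    using \<omega> by (auto simp: tuples_def)
  have "[x, y] \<in> tuples L (Suc 1)"
    using xy by (simp add: tuples_def)
  \<comment> \<open>Explicit index sets let the finite sums be evaluated; the inner sum at j = 0 is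
    empty.\<close>
  moreover have "{..<1} = {0::nat}" "{..1} = {0, 1::nat}" "{..<0} = ({}::nat set)" by auto
  ultimately show ?thesis
    using xy unfolding coboundary_def
    by (simp add: alt_def omit_def twist_pred_def a_minus_def Pi_def del: lessThan_Suc)
qed

text \<open>Terms are grouped by sign, so that vanishing becomes an equation between sums. Its two
  sides mirror the Hom-Leibniz identity for x, y, z: the positive terms belong to the bracket of
  \<alpha> x with [y, z].\<close>

lemma coboundary_2:
  assumes \<omega>: "\<omega> \<in> tuples L 2 \<rightarrow> carrier M"
    and xyz: "x \<in> carrier L" "y \<in> carrier L" "z \<in> carrier L"
  shows "coboundary L M 2 \<omega> [x, y, z] =
    (\<alpha>\<^bsub>L\<^esub> x \<triangleright> \<omega> [y, z] \<oplus> \<omega> [\<alpha>\<^bsub>L\<^esub> x, \<langle>y, z\<rangle>\<^bsub>L\<^esub>]) \<ominus>\<^bsub>M\<^esub>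
    (\<omega> [x, y] \<triangleleft> \<alpha>\<^bsub>L\<^esub> z \<oplus> \<omega> [\<langle>x, y\<rangle>\<^bsub>L\<^esub>, \<alpha>\<^bsub>L\<^esub> z] \<oplus>
     \<alpha>\<^bsub>L\<^esub> y \<triangleright> \<omega> [x, z] \<oplus> \<omega> [\<alpha>\<^bsub>L\<^esub> y, \<langle>x, z\<rangle>\<^bsub>L\<^esub>])"
proof -
  have [simp]: "u \<in> carrier L \<Longrightarrow> v \<in> carrier L \<Longrightarrow> \<omega> [u, v] \<in> carrier M" for u v
    using \<omega> by (auto simp: tuples_def)
  have "[x, y, z] \<in> tuples L (Suc 2)"
    using xyz by (simp add: tuples_def)
  moreover have "{..<2} = {0, 1::nat}" "{..2} = {0, 1, 2::nat}" "{..<0} = ({}::nat set)" "{..<1} = {0::nat}"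
    by auto
  \<comment> \<open>The right action enters with sign (-1)^3; this is the parity of 3 in the form
    left once numerals are unfolded.\<close>
  moreover have "\<not> Suc (Suc 0) dvd Suc (Suc (Suc 0))"
    by presburger
  ultimately show ?thesis
    using xyz unfolding coboundary_def
    by (simp add: alt_def omit_def twist_pred_def a_minus_def Pi_def M.V.minus_add M.V.a_ac
        numeral_2_eq_2 del: lessThan_Suc)
qed

end

subsection \<open>Coordinates on a split extension\<close>

text \<open>The difference is killed by \<open>proj E\<close>, hence lies in the range of the
  injective \<open>incl E\<close>, and \<open>inv_into\<close> recovers its preimage. The
  restriction to pairs makes the result extensional, as membership in \<open>cochains\<close>
  demands.\<close>

definition factor_set ::
    "('a, 'l) hlr \<Rightarrow> ('a, 'l, 'm) hlr_rep \<Rightarrow> ('a, 'l, 'm, 'e) extension \<Rightarrow> ('l \<Rightarrow> 'e) \<Rightarrow>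
     'l list \<Rightarrow> 'm" where
  "factor_set L M E \<tau> = (\<lambda>xs\<in>tuples L 2. inv_into (carrier M) (incl E)
     (\<langle>\<tau> (xs ! 0), \<tau> (xs ! 1)\<rangle>\<^bsub>total E\<^esub> \<ominus>\<^bsub>total E\<^esub> \<tau> \<langle>xs ! 0, xs ! 1\<rangle>\<^bsub>L\<^esub>))"

text \<open>This is \<open>A_split\<close> with its witness exposed, so that the splittings of one
  extension can be compared.\<close>

definition splitting ::
    "('k, 'a) module \<Rightarrow> ('a, 'l) hlr \<Rightarrow> ('a, 'l, 'm, 'e) extension \<Rightarrow> ('l \<Rightarrow> 'e) \<Rightarrow> bool" where
  "splitting A L E \<tau> \<longleftrightarrow>
     hom_module_map A L (total E) \<tau> \<and> (\<forall>x\<in>carrier L. proj E (\<tau> x) = x)"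

text \<open>The splitting is a parameter next to the extension: comparing two splittings, or two
  extensions, means interpreting the locale twice and relating the two systems of
  coordinates.\<close>

locale split_extension = hlr_representation K A \<phi> L M
  for K :: "'k ring" and A :: "('k, 'a) module" and \<phi> :: "'a \<Rightarrow> 'a"
    and L :: "('a, 'l) hlr" and M :: "('a, 'l, 'm) hlr_rep" (structure) +
  fixes E :: "('a, 'l, 'm, 'e) extension" and \<tau> :: "'l \<Rightarrow> 'e"
  assumes extension: "abelian_extension K A \<phi> L M E"
    and splitting: "splitting A L E \<tau>"
begin

sublocale T: hom_leibniz_rinehart K A \<phi> "total E"
  using extension by (simp add: abelian_extension_def)

abbreviation add_total (infixl \<open>\<oplus>\<^sub>E\<close> 65) where "add_total \<equiv> add (total E)"

lemma incl_closed [simp]: "m \<in> carrier M \<Longrightarrow> incl E m \<in> carrier (total E)"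
  and incl_add: "\<lbrakk>m \<in> carrier M; n \<in> carrier M\<rbrakk> \<Longrightarrow> incl E (m \<oplus> n) = incl E m \<oplus>\<^sub>E incl E n"
  and incl_smult: "\<lbrakk>f \<in> carrier A; m \<in> carrier M\<rbrakk> \<Longrightarrow> incl E (f \<odot>\<^bsub>M\<^esub> m) = f \<odot>\<^bsub>total E\<^esub> incl E m"
  and incl_twist: "m \<in> carrier M \<Longrightarrow> incl E (\<alpha> m) = \<alpha>\<^bsub>total E\<^esub> (incl E m)"
  using extension
  by (auto simp: abelian_extension_def hom_module_map_def A_linear_def additive_map_def)

lemma incl_zero [simp]: "incl E \<zero> = \<zero>\<^bsub>total E\<^esub>"
  using extension additive_map_zero[OF M.V.abelian_group_axioms T.V.abelian_group_axioms]
  by (auto simp: abelian_extension_def hom_module_map_def A_linear_def)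

lemma incl_inj_iff: "\<lbrakk>m \<in> carrier M; n \<in> carrier M\<rbrakk> \<Longrightarrow> incl E m = incl E n \<longleftrightarrow> m = n"
  using extension by (auto simp: abelian_extension_def inj_on_def)

lemma proj_incl [simp]: "m \<in> carrier M \<Longrightarrow> proj E (incl E m) = \<zero>\<^bsub>L\<^esub>"
  using extension by (auto simp: abelian_extension_def)

lemma kernel_proj:
  assumes "e \<in> carrier (total E)" "proj E e = \<zero>\<^bsub>L\<^esub>"
  obtains m where "m \<in> carrier M" "e = incl E m"
proof -
  have "e \<in> incl E ` carrier M"
    using assms extension by (simp add: abelian_extension_def)
  then show thesis using that by blast
qed

lemma proj_closed [simp]: "e \<in> carrier (total E) \<Longrightarrow> proj E e \<in> carrier L"
  using extension by (auto simp: abelian_extension_def)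

lemma proj_add:
  "\<lbrakk>d \<in> carrier (total E); e \<in> carrier (total E)\<rbrakk> \<Longrightarrow>
    proj E (d \<oplus>\<^sub>E e) = proj E d \<oplus>\<^bsub>L\<^esub> proj E e"
  and proj_bracket: "\<lbrakk>d \<in> carrier (total E); e \<in> carrier (total E)\<rbrakk> \<Longrightarrow>
    proj E \<langle>d, e\<rangle>\<^bsub>total E\<^esub> = \<langle>proj E d, proj E e\<rangle>\<^bsub>L\<^esub>"
  and anchor_proj: "\<lbrakk>e \<in> carrier (total E); f \<in> carrier A\<rbrakk> \<Longrightarrow>
      lanchor (total E) e f = lanchor L (proj E e) f"
    "\<lbrakk>e \<in> carrier (total E); f \<in> carrier A\<rbrakk> \<Longrightarrow>
      ranchor (total E) e f = ranchor L (proj E e) f"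
  using extension
  by (auto simp: abelian_extension_def hlr_map_def hom_module_map_def A_linear_def additive_map_def)

lemma bracket_incl:
    "\<lbrakk>m \<in> carrier M; e \<in> carrier (total E)\<rbrakk> \<Longrightarrow> \<langle>incl E m, e\<rangle>\<^bsub>total E\<^esub> = incl E (m \<triangleleft> proj E e)"
    "\<lbrakk>m \<in> carrier M; e \<in> carrier (total E)\<rbrakk> \<Longrightarrow> \<langle>e, incl E m\<rangle>\<^bsub>total E\<^esub> = incl E (proj E e \<triangleright> m)"
  using extension by (auto simp: abelian_extension_def)

lemma splitting_closed [simp]: "x \<in> carrier L \<Longrightarrow> \<tau> x \<in> carrier (total E)"
  and splitting_add: "\<lbrakk>x \<in> carrier L; y \<in> carrier L\<rbrakk> \<Longrightarrow> \<tau> (x \<oplus>\<^bsub>L\<^esub> y) = \<tau> x \<oplus>\<^sub>E \<tau> y"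
  and splitting_smult: "\<lbrakk>f \<in> carrier A; x \<in> carrier L\<rbrakk> \<Longrightarrow> \<tau> (f \<odot>\<^bsub>L\<^esub> x) = f \<odot>\<^bsub>total E\<^esub> \<tau> x"
  and splitting_twist: "x \<in> carrier L \<Longrightarrow> \<tau> (\<alpha>\<^bsub>L\<^esub> x) = \<alpha>\<^bsub>total E\<^esub> (\<tau> x)"
  and proj_splitting [simp]: "x \<in> carrier L \<Longrightarrow> proj E (\<tau> x) = x"
  using splitting
  by (auto simp: splitting_def hom_module_map_def A_linear_def additive_map_def)

lemma splitting_zero [simp]: "\<tau> \<zero>\<^bsub>L\<^esub> = \<zero>\<^bsub>total E\<^esub>"
  using splitting additive_map_zero[OF L.V.abelian_group_axioms T.V.abelian_group_axioms]
  by (auto simp: splitting_def hom_module_map_def A_linear_def)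

definition coord :: "'l \<Rightarrow> 'm \<Rightarrow> 'e" where
  "coord x m = \<tau> x \<oplus>\<^sub>E incl E m"

lemma coord_closed [simp]:
  "\<lbrakk>x \<in> carrier L; m \<in> carrier M\<rbrakk> \<Longrightarrow> coord x m \<in> carrier (total E)"
  by (simp add: coord_def)

lemma proj_coord [simp]: "\<lbrakk>x \<in> carrier L; m \<in> carrier M\<rbrakk> \<Longrightarrow> proj E (coord x m) = x"
  by (simp add: coord_def proj_add)

text \<open>Read from right to left, the first rule puts \<open>\<tau> x\<close> into coordinates,
  so that an identity between lifted elements becomes one identity in L and one in M.\<close>

lemma coord_zero: "x \<in> carrier L \<Longrightarrow> coord x \<zero> = \<tau> x"
  "m \<in> carrier M \<Longrightarrow> coord \<zero>\<^bsub>L\<^esub> m = incl E m"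
  by (simp_all add: coord_def)

lemma coord_eq_iff:
  assumes "x \<in> carrier L" "m \<in> carrier M" "y \<in> carrier L" "n \<in> carrier M"
  shows "coord x m = coord y n \<longleftrightarrow> x = y \<and> m = n"
proof
  assume eq: "coord x m = coord y n"
  then have "x = y" using proj_coord assms by metis
  with eq show "x = y \<and> m = n" using assms by (simp add: coord_def incl_inj_iff)
qed simp

text \<open>Subtracting from e the lift of its projection leaves an element of the kernel, which is
  the image of M.\<close>

lemma coordE:
  assumes "e \<in> carrier (total E)"
  obtains m where "m \<in> carrier M" "e = coord (proj E e) m"
proof -
  let ?d = "e \<ominus>\<^bsub>total E\<^esub> \<tau> (proj E e)"
  have d: "?d \<oplus>\<^sub>E \<tau> (proj E e) = e" "?d \<in> carrier (total E)"
    using assms by (simp_all add: T.V.minus_add_cancel)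
  then have "proj E ?d \<oplus>\<^bsub>L\<^esub> proj E e = proj E e"
    using assms proj_add[of ?d "\<tau> (proj E e)"] by simp
  then have "proj E ?d = \<zero>\<^bsub>L\<^esub>"
    using assms d(2) by simp
  then obtain m where "m \<in> carrier M" "?d = incl E m"
    using d(2) kernel_proj by blast
  then show thesis
    using that[of m] d assms by (simp add: coord_def T.V.a_comm)
qed

lemma coord_add:
  assumes "x \<in> carrier L" "m \<in> carrier M" "y \<in> carrier L" "n \<in> carrier M"
  shows "coord x m \<oplus>\<^sub>E coord y n = coord (x \<oplus>\<^bsub>L\<^esub> y) (m \<oplus> n)"
  using assms by (simp add: coord_def incl_add splitting_add T.V.a_ac)

lemma coord_smult:
  assumes "f \<in> carrier A" "x \<in> carrier L" "m \<in> carrier M"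
  shows "f \<odot>\<^bsub>total E\<^esub> coord x m = coord (f \<odot>\<^bsub>L\<^esub> x) (f \<odot>\<^bsub>M\<^esub> m)"
  using assms by (simp add: coord_def incl_smult splitting_smult T.V.smult_r_distr)

lemma coord_twist:
  assumes "x \<in> carrier L" "m \<in> carrier M"
  shows "\<alpha>\<^bsub>total E\<^esub> (coord x m) = coord (\<alpha>\<^bsub>L\<^esub> x) (\<alpha> m)"
  using assms by (simp add: coord_def incl_twist splitting_twist T.twist_add)

abbreviation h where "h x y \<equiv> factor_set L M E \<tau> [x, y]"

text \<open>The projection preserves brackets, so the bracket of two lifts has first coordinate
  [x, y]; its second coordinate is what \<open>inv_into\<close> returns. Later proofs reach the
  values of \<open>h\<close> only through this equation.\<close>

lemma factor_set_closed_and_bracket: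
  assumes "x \<in> carrier L" "y \<in> carrier L"
  shows "h x y \<in> carrier M \<and> \<langle>\<tau> x, \<tau> y\<rangle>\<^bsub>total E\<^esub> = coord \<langle>x, y\<rangle>\<^bsub>L\<^esub> (h x y)"
proof -
  obtain m where m: "m \<in> carrier M" "\<langle>\<tau> x, \<tau> y\<rangle>\<^bsub>total E\<^esub> = coord \<langle>x, y\<rangle>\<^bsub>L\<^esub> m"
    using coordE[of "\<langle>\<tau> x, \<tau> y\<rangle>\<^bsub>total E\<^esub>"] assms by (auto simp: proj_bracket)
  then have "\<langle>\<tau> x, \<tau> y\<rangle>\<^bsub>total E\<^esub> \<ominus>\<^bsub>total E\<^esub> \<tau> \<langle>x, y\<rangle>\<^bsub>L\<^esub> = incl E m"
    using assms by (simp add: T.V.minus_eq_iff coord_def T.V.a_comm)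
  moreover have "inj_on (incl E) (carrier M)"
    by (auto simp: inj_on_def incl_inj_iff)
  ultimately have "h x y = m"
    using assms m by (simp add: factor_set_def tuples_def)
  then show ?thesis using m by simp
qed

lemmas factor_set_closed [simp] = factor_set_closed_and_bracket[THEN conjunct1]
  and splitting_bracket = factor_set_closed_and_bracket[THEN conjunct2]

text \<open>Second coordinates are unique, so a function that describes the brackets of lifts is the
  factor set. Every identification of factor sets below goes through this criterion.\<close>

lemma factor_set_eqI:
  assumes "h' \<in> extensional (tuples L 2)"
    and "\<And>x y. \<lbrakk>x \<in> carrier L; y \<in> carrier L\<rbrakk> \<Longrightarrow> h' [x, y] \<in> carrier M"
    and "\<And>x y. \<lbrakk>x \<in> carrier L; y \<in> carrier L\<rbrakk> \<Longrightarrow> \<langle>\<tau> x, \<tau> y\<rangle>\<^bsub>total E\<^esub> = coord \<langle>x, y\<rangle>\<^bsub>L\<^esub> (h' [x, y])"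
  shows "factor_set L M E \<tau> = h'"
proof (rule extensionalityI)
  show "factor_set L M E \<tau> \<in> extensional (tuples L 2)"
    by (simp add: factor_set_def)
  show "factor_set L M E \<tau> xs = h' xs" if "xs \<in> tuples L 2" for xs
    using that assms(2,3) by (auto simp: tuples_2 splitting_bracket coord_eq_iff)
qed (fact assms(1))

lemma coord_bracket:
  assumes "x \<in> carrier L" "m \<in> carrier M" "y \<in> carrier L" "n \<in> carrier M"
  shows "\<langle>coord x m, coord y n\<rangle>\<^bsub>total E\<^esub> =
    coord \<langle>x, y\<rangle>\<^bsub>L\<^esub> (h x y \<oplus> x \<triangleright> n \<oplus> m \<triangleleft> y)"
proof -
  \<comment> \<open>One factor acts on the other through its projection, which is zero, so the
    summand with both entries from M disappears.\<close>
  have "\<langle>incl E m, incl E n\<rangle>\<^bsub>total E\<^esub> = \<zero>\<^bsub>total E\<^esub>"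
    using assms by (simp add: bracket_incl)
  then have "\<langle>coord x m, coord y n\<rangle>\<^bsub>total E\<^esub> =
      coord \<langle>x, y\<rangle>\<^bsub>L\<^esub> (h x y) \<oplus>\<^sub>E incl E (m \<triangleleft> y) \<oplus>\<^sub>E incl E (x \<triangleright> n)"
    using assms unfolding coord_def[of x] coord_def[of y]
    by (simp add: T.bracket_add_left T.bracket_add_right bracket_incl proj_add splitting_bracket)
  then show ?thesis
    using assms by (simp add: coord_def incl_add T.V.a_ac)
qed

lemma coord_anchor:
  assumes "x \<in> carrier L" "m \<in> carrier M" "f \<in> carrier A"
  shows "lanchor (total E) (coord x m) f = lanchor L x f"
    and "ranchor (total E) (coord x m) f = ranchor L x f"
  using assms by (simp_all add: anchor_proj)

lemma factor_set_cochain: "factor_set L M E \<tau> \<in> cochains A \<phi> L M 2"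
  unfolding cochains_2_iff
proof (intro conjI ballI)
  show "factor_set L M E \<tau> \<in> tuples L 2 \<rightarrow>\<^sub>E carrier M"
    by (auto simp: PiE_iff tuples_2) (simp add: factor_set_def)
next
  fix x y z assume xyz: "x \<in> carrier L" "y \<in> carrier L" "z \<in> carrier L"
  show "h (x \<oplus>\<^bsub>L\<^esub> y) z = h x z \<oplus> h y z"
    using xyz T.bracket_add_left[of "\<tau> x" "\<tau> y" "\<tau> z"] splitting_bracket[of "x \<oplus>\<^bsub>L\<^esub> y" z]
    by (simp add: splitting_add splitting_bracket coord_add coord_eq_iff L.bracket_add_left)
  show "h x (y \<oplus>\<^bsub>L\<^esub> z) = h x y \<oplus> h x z"
    using xyz T.bracket_add_right[of "\<tau> x" "\<tau> y" "\<tau> z"] splitting_bracket[of x "y \<oplus>\<^bsub>L\<^esub> z"]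
    by (simp add: splitting_add splitting_bracket coord_add coord_eq_iff L.bracket_add_right)
next
  fix f x y assume f: "f \<in> carrier A" and xy: "x \<in> carrier L" "y \<in> carrier L"
  show "h x (f \<odot>\<^bsub>L\<^esub> y) = \<phi> f \<odot>\<^bsub>M\<^esub> h x y"
  proof -
    \<comment> \<open>The anchor term is a multiple of the lift of \<alpha> y and so has second
      coordinate zero. It is absorbed by the anchor term of the bracket in L, and \<open>h\<close>
      is left without a derivation term.\<close>
    have "\<langle>\<tau> x, \<tau> (f \<odot>\<^bsub>L\<^esub> y)\<rangle>\<^bsub>total E\<^esub> =
        \<phi> f \<odot>\<^bsub>total E\<^esub> \<langle>\<tau> x, \<tau> y\<rangle>\<^bsub>total E\<^esub> \<oplus>\<^sub>E lanchor L x f \<odot>\<^bsub>total E\<^esub> \<tau> (\<alpha>\<^bsub>L\<^esub> y)"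
      using f xy by (simp add: splitting_smult T.bracket_smult_right anchor_proj splitting_twist)
    then show ?thesis
      using f xy by (simp add: coord_zero(1)[symmetric] coord_bracket coord_smult coord_add
          coord_eq_iff del: splitting_closed)
  qed
  show "h (f \<odot>\<^bsub>L\<^esub> x) y = \<phi> f \<odot>\<^bsub>M\<^esub> h x y"
  proof -
    \<comment> \<open>The subtracted anchor term is moved to the left side because the coordinate
      rules cover sums, not differences.\<close>
    have "\<langle>\<tau> (f \<odot>\<^bsub>L\<^esub> x), \<tau> y\<rangle>\<^bsub>total E\<^esub> \<oplus>\<^sub>E ranchor L y f \<odot>\<^bsub>total E\<^esub> \<tau> (\<alpha>\<^bsub>L\<^esub> x) =
        \<phi> f \<odot>\<^bsub>total E\<^esub> \<langle>\<tau> x, \<tau> y\<rangle>\<^bsub>total E\<^esub>"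
      using f xy by (simp add: splitting_smult T.bracket_smult_left anchor_proj splitting_twist
          T.V.minus_add_cancel)
    then show ?thesis
      using f xy by (simp add: coord_zero(1)[symmetric] coord_bracket coord_smult coord_add
          coord_eq_iff del: splitting_closed)
  qed
next
  fix x y assume xy: "x \<in> carrier L" "y \<in> carrier L"
  show "h (\<alpha>\<^bsub>L\<^esub> x) (\<alpha>\<^bsub>L\<^esub> y) = \<alpha> (h x y)"
    using xy T.twist_bracket[of "\<tau> x" "\<tau> y"] splitting_bracket[of "\<alpha>\<^bsub>L\<^esub> x" "\<alpha>\<^bsub>L\<^esub> y"]
    by (simp add: splitting_twist splitting_bracket coord_twist L.twist_bracket coord_eq_iff)
qed

lemma factor_set_cocycle: "factor_set L M E \<tau> \<in> cocycles A \<phi> L M 2"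
proof -
  have "coboundary L M 2 (factor_set L M E \<tau>) xs = \<zero>" if xs: "xs \<in> tuples L 3" for xs
  proof -
    obtain x y z where xyz: "x \<in> carrier L" "y \<in> carrier L" "z \<in> carrier L" "xs = [x, y, z]"
      using xs by (auto simp: tuples_3)
    have "\<langle>\<tau> (\<alpha>\<^bsub>L\<^esub> x), \<langle>\<tau> y, \<tau> z\<rangle>\<^bsub>total E\<^esub>\<rangle>\<^bsub>total E\<^esub> =
        \<langle>\<langle>\<tau> x, \<tau> y\<rangle>\<^bsub>total E\<^esub>, \<tau> (\<alpha>\<^bsub>L\<^esub> z)\<rangle>\<^bsub>total E\<^esub> \<oplus>\<^sub>E
        \<langle>\<tau> (\<alpha>\<^bsub>L\<^esub> y), \<langle>\<tau> x, \<tau> z\<rangle>\<^bsub>total E\<^esub>\<rangle>\<^bsub>total E\<^esub>"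
      using xyz T.hom_leibniz[of "\<tau> x" "\<tau> y" "\<tau> z"] by (simp add: splitting_twist)
    \<comment> \<open>The lifts of x, y, z have second coordinate zero, so the second coordinate of
      the Hom-Leibniz identity contains only values of \<open>h\<close> and actions of L on them:
      the terms of the cocycle condition.\<close>
    then have "coord \<langle>\<alpha>\<^bsub>L\<^esub> x, \<langle>y, z\<rangle>\<^bsub>L\<^esub>\<rangle>\<^bsub>L\<^esub> (h (\<alpha>\<^bsub>L\<^esub> x) \<langle>y, z\<rangle>\<^bsub>L\<^esub> \<oplus> \<alpha>\<^bsub>L\<^esub> x \<triangleright> h y z) =
        coord (\<langle>\<langle>x, y\<rangle>\<^bsub>L\<^esub>, \<alpha>\<^bsub>L\<^esub> z\<rangle>\<^bsub>L\<^esub> \<oplus>\<^bsub>L\<^esub> \<langle>\<alpha>\<^bsub>L\<^esub> y, \<langle>x, z\<rangle>\<^bsub>L\<^esub>\<rangle>\<^bsub>L\<^esub>)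
          ((h \<langle>x, y\<rangle>\<^bsub>L\<^esub> (\<alpha>\<^bsub>L\<^esub> z) \<oplus> h x y \<triangleleft> \<alpha>\<^bsub>L\<^esub> z) \<oplus>
           (h (\<alpha>\<^bsub>L\<^esub> y) \<langle>x, z\<rangle>\<^bsub>L\<^esub> \<oplus> \<alpha>\<^bsub>L\<^esub> y \<triangleright> h x z))"
      using xyz
      by (simp add: coord_zero(1)[symmetric] coord_bracket coord_add del: splitting_closed)
    then have "h (\<alpha>\<^bsub>L\<^esub> x) \<langle>y, z\<rangle>\<^bsub>L\<^esub> \<oplus> \<alpha>\<^bsub>L\<^esub> x \<triangleright> h y z =
        (h \<langle>x, y\<rangle>\<^bsub>L\<^esub> (\<alpha>\<^bsub>L\<^esub> z) \<oplus> h x y \<triangleleft> \<alpha>\<^bsub>L\<^esub> z) \<oplus>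
        (h (\<alpha>\<^bsub>L\<^esub> y) \<langle>x, z\<rangle>\<^bsub>L\<^esub> \<oplus> \<alpha>\<^bsub>L\<^esub> y \<triangleright> h x z)"
      using xyz by (subst (asm) coord_eq_iff) simp_all
    then have "\<alpha>\<^bsub>L\<^esub> x \<triangleright> h y z \<oplus> h (\<alpha>\<^bsub>L\<^esub> x) \<langle>y, z\<rangle>\<^bsub>L\<^esub> =
        h x y \<triangleleft> \<alpha>\<^bsub>L\<^esub> z \<oplus> h \<langle>x, y\<rangle>\<^bsub>L\<^esub> (\<alpha>\<^bsub>L\<^esub> z) \<oplus>
        \<alpha>\<^bsub>L\<^esub> y \<triangleright> h x z \<oplus> h (\<alpha>\<^bsub>L\<^esub> y) \<langle>x, z\<rangle>\<^bsub>L\<^esub>"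
      using xyz by (simp add: M.V.a_ac)
    moreover have "factor_set L M E \<tau> \<in> tuples L 2 \<rightarrow> carrier M"
      by (auto simp: tuples_2)
    ultimately show ?thesis
      using xyz by (simp add: coboundary_2 M.V.minus_eq_iff)
  qed
  then show ?thesis
    using factor_set_cochain by (simp add: cocycles_def eval_nat_numeral)
qed

text \<open>A section has first coordinate x at x. Uniqueness of the second coordinate then
  transfers additivity, A-linearity and compatibility with the twists from \<open>\<tau>'\<close> to
  \<omega>.\<close>

lemma splitting_cochain:
  assumes "splitting A L E \<tau>'"
  obtains \<omega> where "\<omega> \<in> cochains A \<phi> L M 1" "\<And>x. x \<in> carrier L \<Longrightarrow> \<tau>' x = coord x (\<omega> [x])"
proof -
  interpret S: split_extension K A \<phi> L M E \<tau>'
    using assms extension by unfold_locales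
  have "\<exists>m\<in>carrier M. \<tau>' x = coord x m" if "x \<in> carrier L" for x
    using that coordE[of "\<tau>' x"] by auto
  then obtain w where w: "\<And>x. x \<in> carrier L \<Longrightarrow> w x \<in> carrier M"
      "\<And>x. x \<in> carrier L \<Longrightarrow> \<tau>' x = coord x (w x)"
    by metis
  define \<omega> where "\<omega> = (\<lambda>xs\<in>tuples L 1. w (hd xs))"
  have \<omega>: "\<omega> [x] = w x" if "x \<in> carrier L" for x
    using that by (simp add: \<omega>_def tuples_def)
  have "\<omega> \<in> cochains A \<phi> L M 1"
    unfolding cochains_1_iff
  proof (intro conjI ballI)
    show "\<omega> \<in> tuples L 1 \<rightarrow>\<^sub>E carrier M"
      using w(1) by (auto simp: \<omega>_def tuples_1[simplified])
    show "\<omega> [x \<oplus>\<^bsub>L\<^esub> y] = \<omega> [x] \<oplus> \<omega> [y]" if "x \<in> carrier L" "y \<in> carrier L" for x y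
      using that w(1) S.splitting_add[of x y] by (simp add: \<omega> w(2) coord_add coord_eq_iff)
    show "\<omega> [f \<odot>\<^bsub>L\<^esub> x] = f \<odot>\<^bsub>M\<^esub> \<omega> [x]" if "f \<in> carrier A" "x \<in> carrier L" for f x
      using that w(1) S.splitting_smult[of f x] by (simp add: \<omega> w(2) coord_smult coord_eq_iff)
    show "\<omega> [\<alpha>\<^bsub>L\<^esub> x] = \<alpha> (\<omega> [x])" if "x \<in> carrier L" for x
      using that w(1) S.splitting_twist[of x] by (simp add: \<omega> w(2) coord_twist coord_eq_iff)
  qed
  then show thesis
    using that w(2) \<omega> by simp
qed

lemma cochain_splitting:
  assumes "\<omega> \<in> cochains A \<phi> L M 1"
  shows "splitting A L E (\<lambda>x. coord x (\<omega> [x]))"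
proof -
  have [simp]: "\<omega> [x] \<in> carrier M" if "x \<in> carrier L" for x
    using assms that unfolding cochains_1_iff by (auto simp: tuples_def)
  show ?thesis
    using assms unfolding cochains_1_iff
    by (auto simp: splitting_def hom_module_map_def A_linear_def additive_map_def
        coord_add coord_smult coord_twist)
qed

text \<open>Moving both lifts by \<omega> adds the two action terms to \<open>h\<close>; the lift of
  [x, y] has moved as well, and its shift has to be subtracted. The coboundary stands on the left of
  the product to match the elements of a right coset.\<close>

lemma factor_set_shift:
  assumes "splitting A L E \<tau>'" and \<omega>: "\<omega> \<in> cochains A \<phi> L M 1"
    and \<tau>': "\<And>x. x \<in> carrier L \<Longrightarrow> \<tau>' x = coord x (\<omega> [x])"
  shows "factor_set L M E \<tau>' =
    coboundary L M 1 \<omega> \<otimes>\<^bsub>cochain_group A \<phi> L M 2\<^esub> factor_set L M E \<tau>"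
proof -
  interpret S: split_extension K A \<phi> L M E \<tau>'
    using assms(1) extension by unfold_locales
  have \<omega>_closed: "\<omega> \<in> tuples L 1 \<rightarrow> carrier M"
    using \<omega> unfolding cochains_1_iff by auto
  then have [simp]: "\<omega> [x] \<in> carrier M" if "x \<in> carrier L" for x
    using that by (auto simp: tuples_def)
  \<comment> \<open>Passing from the coordinates of \<open>\<tau>'\<close> to those of
    \<open>\<tau>\<close> translates the second one by \<omega>.\<close>
  have coord': "S.coord x m = coord x (\<omega> [x] \<oplus> m)" if "x \<in> carrier L" "m \<in> carrier M" for x m
    using that by (simp add: S.coord_def \<tau>' coord_def incl_add T.V.a_assoc)
  define b where "b = coboundary L M 1 \<omega> \<otimes>\<^bsub>cochain_group A \<phi> L M 2\<^esub> factor_set L M E \<tau>"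
  have sum: "b [x, y] =
      (x \<triangleright> \<omega> [y] \<oplus> \<omega> [x] \<triangleleft> y \<ominus>\<^bsub>M\<^esub> \<omega> [\<langle>x, y\<rangle>\<^bsub>L\<^esub>]) \<oplus> h x y"
    if "x \<in> carrier L" "y \<in> carrier L" for x y
    using that \<omega>_closed coboundary_1[of \<omega> x y] by (simp add: b_def cochain_group_def tuples_def)
  show ?thesis
    unfolding b_def[symmetric]
  proof (rule S.factor_set_eqI)
    show "b \<in> extensional (tuples L 2)"
      by (simp add: b_def cochain_group_def)
    fix x y assume xy: "x \<in> carrier L" "y \<in> carrier L"
    show "b [x, y] \<in> carrier M"
      using xy by (simp add: sum)
    \<comment> \<open>The translation at [x, y] cancels the last term of the coboundary.\<close>
    have "\<omega> [\<langle>x, y\<rangle>\<^bsub>L\<^esub>] \<oplus> (x \<triangleright> \<omega> [y] \<oplus> \<omega> [x] \<triangleleft> y \<ominus>\<^bsub>M\<^esub> \<omega> [\<langle>x, y\<rangle>\<^bsub>L\<^esub>] \<oplus> h x y) =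
      (x \<triangleright> \<omega> [y] \<oplus> \<omega> [x] \<triangleleft> y \<ominus>\<^bsub>M\<^esub> \<omega> [\<langle>x, y\<rangle>\<^bsub>L\<^esub>] \<oplus> \<omega> [\<langle>x, y\<rangle>\<^bsub>L\<^esub>]) \<oplus> h x y"
      using xy by (simp add: M.V.a_ac)
    also have "\<dots> = h x y \<oplus> x \<triangleright> \<omega> [y] \<oplus> \<omega> [x] \<triangleleft> y"
      using xy by (subst M.V.minus_add_cancel) (simp_all add: M.V.a_ac)
    finally show "\<langle>\<tau>' x, \<tau>' y\<rangle>\<^bsub>total E\<^esub> = S.coord \<langle>x, y\<rangle>\<^bsub>L\<^esub>
        (b [x, y])"
      using xy by (simp add: sum \<tau>' coord' coord_bracket)
  qed
qed

end

section \<open>The class of an extension and its invariance under equivalence\<close>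

text \<open>Collecting the factor sets of all splittings makes the invariant depend on the extension
  alone and gives it the type of a coset.\<close>

definition extension_class ::
    "('k, 'a) module \<Rightarrow> ('a, 'l) hlr \<Rightarrow> ('a, 'l, 'm) hlr_rep \<Rightarrow> ('a, 'l, 'm, 'e) extension \<Rightarrow>
     ('l list \<Rightarrow> 'm) set" where
  "extension_class A L M E = factor_set L M E ` {\<tau>. splitting A L E \<tau>}"

text \<open>One inclusion holds because any other splitting is a shift by a 1-cochain, the other
  because every 1-cochain occurs as such a shift. The representative on the right may come from any
  splitting.\<close>

lemma (in split_extension) extension_class_eq:
  "extension_class A L M E =
     coboundary L M 1 ` cochains A \<phi> L M 1 #>\<^bsub>cochain_group A \<phi> L M 2\<^esub> factor_set L M E \<tau>"
proof (intro equalityI subsetI)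
  fix h' assume "h' \<in> extension_class A L M E"
  then obtain \<tau>' where \<tau>': "splitting A L E \<tau>'" "h' = factor_set L M E \<tau>'"
    by (auto simp: extension_class_def)
  obtain \<omega> where "\<omega> \<in> cochains A \<phi> L M 1" "\<And>x. x \<in> carrier L \<Longrightarrow> \<tau>' x = coord x (\<omega> [x])"
    using splitting_cochain[OF \<tau>'(1)] by blast
  then show "h' \<in> coboundary L M 1 ` cochains A \<phi> L M 1 #>\<^bsub>cochain_group A \<phi> L M 2\<^esub> factor_set L M E \<tau>"
    using factor_set_shift[OF \<tau>'(1)] \<tau>'(2) by (auto simp: r_coset_def)
next
  fix h' assume "h' \<in> coboundary L M 1 ` cochains A \<phi> L M 1 #>\<^bsub>cochain_group A \<phi> L M 2\<^esub> factor_set L M E \<tau>"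
  then obtain \<omega> where \<omega>: "\<omega> \<in> cochains A \<phi> L M 1"
      "h' = coboundary L M 1 \<omega> \<otimes>\<^bsub>cochain_group A \<phi> L M 2\<^esub> factor_set L M E \<tau>"
    unfolding r_coset_def by blast
  then have "h' = factor_set L M E (\<lambda>x. coord x (\<omega> [x]))"
    using factor_set_shift[OF cochain_splitting[OF \<omega>(1)] \<omega>(1)] by simp
  then show "h' \<in> extension_class A L M E"
    using cochain_splitting[OF \<omega>(1)] by (simp add: extension_class_def)
qed

text \<open>Being additive and the identity on M, \<Phi> carries coordinates for
  \<open>\<tau>\<close> to the same coordinates for \<open>\<Phi> \<circ> \<tau>\<close>. The
  bracket equation that characterises the factor set is transported unchanged.\<close>

lemma (in split_extension) equivalent_factor_set:
  assumes E': "abelian_extension K A \<phi> L M E'"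
    and \<Phi>: "hlr_map A (total E) (total E') \<Phi>"
      "\<And>m. m \<in> carrier M \<Longrightarrow> \<Phi> (incl E m) = incl E' m"
      "\<And>e. e \<in> carrier (total E) \<Longrightarrow> proj E' (\<Phi> e) = proj E e"
  shows "splitting A L E' (\<Phi> \<circ> \<tau>)" and "factor_set L M E' (\<Phi> \<circ> \<tau>) = factor_set L M E \<tau>"
proof -
  show split: "splitting A L E' (\<Phi> \<circ> \<tau>)"
    using splitting \<Phi>
    by (auto simp: splitting_def hlr_map_def hom_module_map_def A_linear_def additive_map_def Pi_iff)
  interpret S: split_extension K A \<phi> L M E' "\<Phi> \<circ> \<tau>"
    using split E' by unfold_locales
  show "factor_set L M E' (\<Phi> \<circ> \<tau>) = factor_set L M E \<tau>"
  proof (rule S.factor_set_eqI)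
    show "factor_set L M E \<tau> \<in> extensional (tuples L 2)"
      by (simp add: factor_set_def)
    fix x y assume xy: "x \<in> carrier L" "y \<in> carrier L"
    then have "\<langle>\<Phi> (\<tau> x), \<Phi> (\<tau> y)\<rangle>\<^bsub>total E'\<^esub> = \<Phi> \<langle>\<tau> x, \<tau> y\<rangle>\<^bsub>total E\<^esub>"
      using \<Phi>(1) by (simp add: hlr_map_def)
    also have "\<dots> = \<Phi> (\<tau> \<langle>x, y\<rangle>\<^bsub>L\<^esub>) \<oplus>\<^bsub>total E'\<^esub> \<Phi> (incl E (h x y))"
      using xy \<Phi>(1)
      by (simp add: splitting_bracket coord_def hlr_map_def hom_module_map_def A_linear_def additive_map_def)
    finally show "\<langle>(\<Phi> \<circ> \<tau>) x, (\<Phi> \<circ> \<tau>) y\<rangle>\<^bsub>total E'\<^esub> = S.coord \<langle>x, y\<rangle>\<^bsub>L\<^esub> (h x y)"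
      using xy \<Phi>(2) by (simp add: S.coord_def)
  qed simp
qed

lemma equivalent_extensionsI:
  assumes "split_extension K A \<phi> L M E \<tau>" "split_extension K A \<phi> L M E' \<tau>'"
    and factor_set: "factor_set L M E \<tau> = factor_set L M E' \<tau>'"
  shows "equivalent_extensions A M E E'"
proof -
  interpret S: split_extension K A \<phi> L M E \<tau> by fact
  interpret S': split_extension K A \<phi> L M E' \<tau>' by fact
  \<comment> \<open>Equal coordinates are matched: x is the projection of e, and m is found by
    inverting \<open>S.coord x\<close> on M.\<close>
  define \<Phi> where
    "\<Phi> e = S'.coord (proj E e) (inv_into (carrier M) (S.coord (proj E e)) e)" for e
  have \<Phi>: "\<Phi> (S.coord x m) = S'.coord x m" if "x \<in> carrier L" "m \<in> carrier M" for x m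
  proof -
    have "inj_on (S.coord x) (carrier M)"
      using that by (auto simp: inj_on_def S.coord_eq_iff)
    then show ?thesis using that by (simp add: \<Phi>_def)
  qed
  have coordE: "\<exists>x\<in>carrier L. \<exists>m\<in>carrier M. e = S.coord x m" if "e \<in> carrier (total E)" for e
    using that S.coordE[OF that] S.proj_closed by metis
  have coordE': "\<exists>x\<in>carrier L. \<exists>m\<in>carrier M. e = S'.coord x m" if "e \<in> carrier (total E')" for e
    using that S'.coordE[OF that] S'.proj_closed by metis
  have "hlr_map A (total E) (total E') \<Phi>"
    unfolding hlr_map_def hom_module_map_def A_linear_def additive_map_def
  proof (intro conjI ballI)
    show "\<Phi> \<in> carrier (total E) \<rightarrow> carrier (total E')"
      by (auto simp: \<Phi> dest!: coordE)
    show "\<Phi> (d \<oplus>\<^bsub>total E\<^esub> e) = \<Phi> d \<oplus>\<^bsub>total E'\<^esub> \<Phi> e"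
      and "\<Phi> \<langle>d, e\<rangle>\<^bsub>total E\<^esub> = \<langle>\<Phi> d, \<Phi> e\<rangle>\<^bsub>total E'\<^esub>"
      if "d \<in> carrier (total E)" "e \<in> carrier (total E)" for d e
      \<comment> \<open>In coordinates the bracket is the one operation that involves the factor
        sets; their equality enters here.\<close>
      using that factor_set
      by (auto simp: \<Phi> S.coord_add S'.coord_add S.coord_bracket S'.coord_bracket dest!: coordE)
    show "\<Phi> (f \<odot>\<^bsub>total E\<^esub> e) = f \<odot>\<^bsub>total E'\<^esub> \<Phi> e"
      and "lanchor (total E') (\<Phi> e) f = lanchor (total E) e f"
      and "ranchor (total E') (\<Phi> e) f = ranchor (total E) e f"
      if "f \<in> carrier A" "e \<in> carrier (total E)" for f e
      using that
      by (auto simp: \<Phi> S.coord_smult S'.coord_smult S.coord_anchor S'.coord_anchor dest!: coordE)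
    show "\<Phi> (\<alpha>\<^bsub>total E\<^esub> e) = \<alpha>\<^bsub>total E'\<^esub> (\<Phi> e)" if "e \<in> carrier (total E)" for e
      using that by (auto simp: \<Phi> S.coord_twist S'.coord_twist dest!: coordE)
  qed
  moreover have "bij_betw \<Phi> (carrier (total E)) (carrier (total E'))"
    unfolding bij_betw_def
  proof (intro conjI equalityI subsetI)
    show "inj_on \<Phi> (carrier (total E))"
      by (auto simp: inj_on_def \<Phi> S.coord_eq_iff S'.coord_eq_iff dest!: coordE)
    show "e \<in> carrier (total E')" if "e \<in> \<Phi> ` carrier (total E)" for e
      using that by (auto simp: \<Phi> dest!: coordE)
    show "e \<in> \<Phi> ` carrier (total E)" if "e \<in> carrier (total E')" for e
      using coordE'[OF that] \<Phi> S.coord_closed by (metis imageI)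
  qed
  moreover have "\<Phi> (incl E m) = incl E' m" if "m \<in> carrier M" for m
    using that \<Phi>[of "\<zero>\<^bsub>L\<^esub>" m] by (simp add: S.coord_zero S'.coord_zero)
  moreover have "proj E' (\<Phi> e) = proj E e" if "e \<in> carrier (total E)" for e
    using coordE[OF that] by (auto simp: \<Phi>)
  ultimately show ?thesis
    unfolding equivalent_extensions_def by blast
qed

subsection \<open>The extension defined by a 2-cocycle\<close>

text \<open>The set L x M is moved into \<open>'e\<close> by \<open>room\<close>, because the
  extensions under classification have their elements there; \<open>l\<close> and \<open>m\<close>
  decode. For h = 0 this is the semidirect product of L and M.\<close>

definition cocycle_total ::
    "('a, 'l) hlr \<Rightarrow> ('a, 'l, 'm) hlr_rep \<Rightarrow> ('l \<times> 'm \<Rightarrow> 'e) \<Rightarrow> ('l list \<Rightarrow> 'm) \<Rightarrow> ('a, 'e) hlr" where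
  "cocycle_total L M room h =
     (let l = \<lambda>u. fst (inv_into (carrier L \<times> carrier M) room u);
          m = \<lambda>u. snd (inv_into (carrier L \<times> carrier M) room u)
      in \<lparr>carrier = room ` (carrier L \<times> carrier M), mult = undefined, one = undefined,
          zero = room (\<zero>\<^bsub>L\<^esub>, \<zero>\<^bsub>M\<^esub>),
          add = (\<lambda>u v. room (l u \<oplus>\<^bsub>L\<^esub> l v, m u \<oplus>\<^bsub>M\<^esub> m v)),
          smult = (\<lambda>f u. room (f \<odot>\<^bsub>L\<^esub> l u, f \<odot>\<^bsub>M\<^esub> m u)),
          twist = (\<lambda>u. room (\<alpha>\<^bsub>L\<^esub> (l u), \<alpha>\<^bsub>M\<^esub> (m u))),
          bracket = (\<lambda>u v. room (\<langle>l u, l v\<rangle>\<^bsub>L\<^esub>,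
            h [l u, l v] \<oplus>\<^bsub>M\<^esub> l u \<triangleright>\<^bsub>M\<^esub> m v \<oplus>\<^bsub>M\<^esub> m u \<triangleleft>\<^bsub>M\<^esub> l v)),
          lanchor = (\<lambda>u. lanchor L (l u)), ranchor = (\<lambda>u. ranchor L (l u))\<rparr>)"

definition cocycle_extension ::
    "('a, 'l) hlr \<Rightarrow> ('a, 'l, 'm) hlr_rep \<Rightarrow> ('l \<times> 'm \<Rightarrow> 'e) \<Rightarrow> ('l list \<Rightarrow> 'm) \<Rightarrow>
     ('a, 'l, 'm, 'e) extension" where
  "cocycle_extension L M room h =
     \<lparr>total = cocycle_total L M room h, incl = (\<lambda>m. room (\<zero>\<^bsub>L\<^esub>, m)),
      proj = (\<lambda>u. fst (inv_into (carrier L \<times> carrier M) room u))\<rparr>"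

text \<open>Scalars act on modules through multiples of 1. As \<phi> fixes these, bringing out
  \<phi> f from a slot of a 2-cochain specialises to K-linearity in that slot.\<close>

lemma (in twisted_algebra) phi_scalar: "c \<in> carrier K \<Longrightarrow> \<phi> (c \<odot>\<^bsub>A\<^esub> \<one>\<^bsub>A\<^esub>) = c \<odot>\<^bsub>A\<^esub> \<one>\<^bsub>A\<^esub>"
  using phi_smult[of c "\<one>\<^bsub>A\<^esub>"] phi_hom by (simp add: ring_hom_def)

lemma (in hom_module) scal_add:
  "\<lbrakk>c \<in> carrier K; x \<in> carrier V; y \<in> carrier V\<rbrakk> \<Longrightarrow> scal A V c (x \<oplus> y) = scal A V c x \<oplus> scal A V c y"
  by (simp add: scal_def V.smult_r_distr)

lemma (in hlr_representation) cochain_bilinear: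
  assumes "h \<in> cochains A \<phi> L M 2"
  shows "K_bilinear K A L L M (\<lambda>x y. h [x, y])"
proof -
  have "h [x, y] \<in> carrier M" if "x \<in> carrier L" "y \<in> carrier L" for x y
    using assms that by (auto simp: cochains_2_iff tuples_2)
  moreover have "c \<odot>\<^bsub>A\<^esub> \<one>\<^bsub>A\<^esub> \<in> carrier A" if "c \<in> carrier K" for c
    using that by simp
  ultimately show ?thesis
    using assms
    by (auto simp: cochains_2_iff K_bilinear_def K_linear_def additive_map_def scal_def L.phi_scalar)
qed

locale cocycle = hlr_representation K A \<phi> L M
  for K :: "'k ring" and A :: "('k, 'a) module" and \<phi> :: "'a \<Rightarrow> 'a"
    and L :: "('a, 'l) hlr" and M :: "('a, 'l, 'm) hlr_rep" (structure) +
  fixes h :: "'l list \<Rightarrow> 'm" and room :: "'l \<times> 'm \<Rightarrow> 'e"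
  assumes cocycle: "h \<in> cocycles A \<phi> L M 2"
    and inj_room: "inj_on room (carrier L \<times> carrier M)"
begin

lemma cochain: "h \<in> cochains A \<phi> L M 2"
  using cocycle by (simp add: cocycles_def)

lemmas bilinear = cochain_bilinear[OF cochain]
lemmas closed [simp] = K_bilinearD(1)[OF bilinear]
lemmas add_right = K_bilinearD(2)[OF bilinear]
lemmas add_left = K_bilinearD(3)[OF bilinear]
lemmas scal_left = K_bilinearD(4)[OF bilinear]
lemmas scal_right = K_bilinearD(5)[OF bilinear]
lemmas zero [simp] =
  K_bilinear_zero[OF L.V.abelian_group_axioms L.V.abelian_group_axioms M.V.abelian_group_axioms
    bilinear]

lemma smult_left:
    "\<lbrakk>f \<in> carrier A; x \<in> carrier L; y \<in> carrier L\<rbrakk> \<Longrightarrow> h [f \<odot>\<^bsub>L\<^esub> x, y] = \<phi> f \<odot>\<^bsub>M\<^esub> h [x, y]"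
  and smult_right:
    "\<lbrakk>f \<in> carrier A; x \<in> carrier L; y \<in> carrier L\<rbrakk> \<Longrightarrow> h [x, f \<odot>\<^bsub>L\<^esub> y] = \<phi> f \<odot>\<^bsub>M\<^esub> h [x, y]"
  and twist:
    "\<lbrakk>x \<in> carrier L; y \<in> carrier L\<rbrakk> \<Longrightarrow> h [\<alpha>\<^bsub>L\<^esub> x, \<alpha>\<^bsub>L\<^esub> y] = \<alpha> (h [x, y])"
  using cochain by (auto simp: cochains_2_iff)

lemma cocycle_eq:
  assumes "x \<in> carrier L" "y \<in> carrier L" "z \<in> carrier L"
  shows "\<alpha>\<^bsub>L\<^esub> x \<triangleright> h [y, z] \<oplus> h [\<alpha>\<^bsub>L\<^esub> x, \<langle>y, z\<rangle>\<^bsub>L\<^esub>] =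
    h [x, y] \<triangleleft> \<alpha>\<^bsub>L\<^esub> z \<oplus> h [\<langle>x, y\<rangle>\<^bsub>L\<^esub>, \<alpha>\<^bsub>L\<^esub> z] \<oplus>
    \<alpha>\<^bsub>L\<^esub> y \<triangleright> h [x, z] \<oplus> h [\<alpha>\<^bsub>L\<^esub> y, \<langle>x, z\<rangle>\<^bsub>L\<^esub>]"
proof -
  have "[x, y, z] \<in> tuples L (Suc 2)"
    using assms by (simp add: tuples_def)
  then have "coboundary L M 2 h [x, y, z] = \<zero>"
    using cocycle unfolding cocycles_def by blast
  moreover have "h \<in> tuples L 2 \<rightarrow> carrier M"
    using cochain by (auto simp: cochains_2_iff)
  ultimately show ?thesis
    using assms by (simp add: coboundary_2 M.V.minus_eq_iff)
qed

lemma decode [simp]: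
  "\<lbrakk>x \<in> carrier L; m \<in> carrier M\<rbrakk> \<Longrightarrow>
     inv_into (carrier L \<times> carrier M) room (room (x, m)) = (x, m)"
  by (rule inv_into_f_f[OF inj_room]) simp

lemma room_eq_iff:
  "\<lbrakk>x \<in> carrier L; m \<in> carrier M; y \<in> carrier L; n \<in> carrier M\<rbrakk> \<Longrightarrow>
     room (x, m) = room (y, n) \<longleftrightarrow> x = y \<and> m = n"
  using inj_room by (auto simp: inj_on_def)

abbreviation E where "E \<equiv> cocycle_extension L M room h"
abbreviation P where "P \<equiv> total E"

lemma room_closed [simp]: "\<lbrakk>x \<in> carrier L; m \<in> carrier M\<rbrakk> \<Longrightarrow> room (x, m) \<in> carrier P"
  by (simp add: cocycle_extension_def cocycle_total_def Let_def)

lemma totalE [elim!]: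
  assumes "u \<in> carrier P"
  obtains x m where "x \<in> carrier L" "m \<in> carrier M" "u = room (x, m)"
  using assms by (auto simp: cocycle_extension_def cocycle_total_def Let_def)

text \<open>The decoding is eliminated here; the later verifications compute with encoded
  pairs.\<close>

lemma total_simps:
  "zero P = room (\<zero>\<^bsub>L\<^esub>, \<zero>)"
  "\<lbrakk>x \<in> carrier L; m \<in> carrier M; y \<in> carrier L; n \<in> carrier M\<rbrakk> \<Longrightarrow>
     room (x, m) \<oplus>\<^bsub>P\<^esub> room (y, n) = room (x \<oplus>\<^bsub>L\<^esub> y, m \<oplus> n)"
  "\<lbrakk>x \<in> carrier L; m \<in> carrier M\<rbrakk> \<Longrightarrow>
     f \<odot>\<^bsub>P\<^esub> room (x, m) = room (f \<odot>\<^bsub>L\<^esub> x, f \<odot>\<^bsub>M\<^esub> m)"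
  "\<lbrakk>x \<in> carrier L; m \<in> carrier M\<rbrakk> \<Longrightarrow> \<alpha>\<^bsub>P\<^esub> (room (x, m)) = room (\<alpha>\<^bsub>L\<^esub> x, \<alpha> m)"
  "\<lbrakk>x \<in> carrier L; m \<in> carrier M; y \<in> carrier L; n \<in> carrier M\<rbrakk> \<Longrightarrow>
     \<langle>room (x, m), room (y, n)\<rangle>\<^bsub>P\<^esub> = room (\<langle>x, y\<rangle>\<^bsub>L\<^esub>, h [x, y] \<oplus> x \<triangleright> n \<oplus> m \<triangleleft> y)"
  "\<lbrakk>x \<in> carrier L; m \<in> carrier M\<rbrakk> \<Longrightarrow> lanchor P (room (x, m)) = lanchor L x"
  "\<lbrakk>x \<in> carrier L; m \<in> carrier M\<rbrakk> \<Longrightarrow> ranchor P (room (x, m)) = ranchor L x"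
  "incl E m = room (\<zero>\<^bsub>L\<^esub>, m)"
  "\<lbrakk>x \<in> carrier L; m \<in> carrier M\<rbrakk> \<Longrightarrow> proj E (room (x, m)) = x"
  by (auto simp: cocycle_extension_def cocycle_total_def Let_def)

lemma total_module: "module A P"
proof (rule moduleI)
  show "cring A"
    by (rule L.M_cring)
  show "abelian_group P"
  proof (rule abelian_groupI)
    fix u assume "u \<in> carrier P"
    then obtain x m where "x \<in> carrier L" "m \<in> carrier M" "u = room (x, m)" ..
    then show "\<exists>v\<in>carrier P. v \<oplus>\<^bsub>P\<^esub> u = \<zero>\<^bsub>P\<^esub>"
      by (intro bexI[of _ "room (\<ominus>\<^bsub>L\<^esub> x, \<ominus> m)"])
        (auto simp: total_simps L.V.l_neg M.V.l_neg)
  qed (auto simp: total_simps room_eq_iff L.V.a_ac M.V.a_ac)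
qed (auto simp: total_simps room_eq_iff L.V.smult_l_distr M.V.smult_l_distr
    L.V.smult_r_distr M.V.smult_r_distr L.V.smult_assoc1 M.V.smult_assoc1)

sublocale P: module A P
  by (rule total_module)

lemma total_scal:
  "\<lbrakk>c \<in> carrier K; x \<in> carrier L; m \<in> carrier M\<rbrakk> \<Longrightarrow>
     scal A P c (room (x, m)) = room (scal A L c x, scal A M c m)"
  by (simp add: scal_def total_simps)

text \<open>Negation in \<open>P\<close> is given by a description and not by a record field, so the
  difference is identified through uniqueness.\<close>

lemma total_minus:
  assumes "x \<in> carrier L" "m \<in> carrier M" "y \<in> carrier L" "n \<in> carrier M"
  shows "room (x, m) \<ominus>\<^bsub>P\<^esub> room (y, n) = room (x \<ominus>\<^bsub>L\<^esub> y, m \<ominus>\<^bsub>M\<^esub> n)"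
proof (rule P.minus_eq_iff[THEN iffD2])
  show "room (x, m) = room (x \<ominus>\<^bsub>L\<^esub> y, m \<ominus>\<^bsub>M\<^esub> n) \<oplus>\<^bsub>P\<^esub> room (y, n)"
    using assms by (simp add: total_simps L.V.minus_add_cancel M.V.minus_add_cancel)
qed (use assms in simp_all)

lemma total_hom_module: "hom_module K A \<phi> P"
proof (intro hom_module.intro hom_module_axioms.intro)
  show "K_linear K A P P \<alpha>\<^bsub>P\<^esub>"
    by (auto simp: K_linear_def additive_map_def total_simps total_scal room_eq_iff
        L.twist_add M.twist_add L.twist_scal M.twist_scal)
  show "bij_betw \<alpha>\<^bsub>P\<^esub> (carrier P) (carrier P)"
    unfolding bij_betw_def
  proof (intro conjI equalityI subsetI)
    show "inj_on \<alpha>\<^bsub>P\<^esub> (carrier P)"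
      by (auto simp: inj_on_def total_simps room_eq_iff L.twist_inj_iff M.twist_inj_iff)
    show "u \<in> carrier P" if "u \<in> \<alpha>\<^bsub>P\<^esub> ` carrier P" for u
      using that by (auto simp: total_simps)
    show "u \<in> \<alpha>\<^bsub>P\<^esub> ` carrier P" if u: "u \<in> carrier P" for u
    proof -
      obtain x m where xm: "x \<in> carrier L" "m \<in> carrier M" "u = room (x, m)"
        using u by blast
      obtain y where "y \<in> carrier L" "x = \<alpha>\<^bsub>L\<^esub> y"
        using xm(1) L.twist_bij unfolding bij_betw_def by blast
      moreover obtain n where "n \<in> carrier M" "m = \<alpha> n"
        using xm(2) M.twist_bij unfolding bij_betw_def by blast
      ultimately show ?thesis
        using xm(3) by (intro image_eqI[of _ _ "room (y, n)"]) (auto simp: total_simps)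
    qed
  qed
qed (auto simp: total_simps L.twist_smult M.twist_smult L.twisted_algebra_axioms total_module)

text \<open>First components satisfy the axioms because L does. In second components the Hom-Leibniz
  identity splits into the cocycle condition and three representation identities, one for each
  position of an element of M.\<close>

lemma total_hlr: "hom_leibniz_rinehart K A \<phi> P"
proof (intro hom_leibniz_rinehart.intro hom_leibniz_rinehart_axioms.intro)
  show "hom_module K A \<phi> P"
    by (rule total_hom_module)
  show "K_bilinear K A P P P (bracket P)"
    by (auto simp: K_bilinear_def K_linear_def additive_map_def total_simps total_scal room_eq_iff
        L.bracket_add_left L.bracket_add_right L.bracket_scal_left L.bracket_scal_right
        add_left add_right scal_left scal_right lact_add_left lact_add_right lact_scal_left
        lact_scal_right ract_add_left ract_add_right ract_scal_left ract_scal_right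
        M.scal_add M.V.a_ac)
  show "\<langle>\<alpha>\<^bsub>P\<^esub> u, \<langle>v, w\<rangle>\<^bsub>P\<^esub>\<rangle>\<^bsub>P\<^esub> =
      \<langle>\<langle>u, v\<rangle>\<^bsub>P\<^esub>, \<alpha>\<^bsub>P\<^esub> w\<rangle>\<^bsub>P\<^esub> \<oplus>\<^bsub>P\<^esub> \<langle>\<alpha>\<^bsub>P\<^esub> v, \<langle>u, w\<rangle>\<^bsub>P\<^esub>\<rangle>\<^bsub>P\<^esub>"
    if uvw: "u \<in> carrier P" "v \<in> carrier P" "w \<in> carrier P" for u v w
  proof -
    obtain x m y n z p where xm: "x \<in> carrier L" "m \<in> carrier M" "u = room (x, m)"
        "y \<in> carrier L" "n \<in> carrier M" "v = room (y, n)"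
        "z \<in> carrier L" "p \<in> carrier M" "w = room (z, p)"
      using uvw by blast
    have "h [\<alpha>\<^bsub>L\<^esub> x, \<langle>y, z\<rangle>\<^bsub>L\<^esub>] \<oplus> \<alpha>\<^bsub>L\<^esub> x \<triangleright> (h [y, z] \<oplus> y \<triangleright> p \<oplus> n \<triangleleft> z) \<oplus> \<alpha> m \<triangleleft> \<langle>y, z\<rangle>\<^bsub>L\<^esub> =
        (\<alpha>\<^bsub>L\<^esub> x \<triangleright> h [y, z] \<oplus> h [\<alpha>\<^bsub>L\<^esub> x, \<langle>y, z\<rangle>\<^bsub>L\<^esub>]) \<oplus> \<alpha>\<^bsub>L\<^esub> x \<triangleright> (y \<triangleright> p) \<oplus>
        \<alpha>\<^bsub>L\<^esub> x \<triangleright> (n \<triangleleft> z) \<oplus> \<alpha> m \<triangleleft> \<langle>y, z\<rangle>\<^bsub>L\<^esub>"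
      using xm by (simp add: lact_add_right M.V.a_ac)
    \<comment> \<open>The identities \<open>rep_MLL\<close>, \<open>rep_LML\<close> and
      \<open>rep_LLM\<close> treat m, n and p, the elements of M in first, second and third
      position. Instances are fixed because \<open>rep_LML\<close> and \<open>rep_MLL\<close> each
      contain the left side of the other on the right and would loop as general rules.\<close>
    also have "\<dots> = (h [x, y] \<triangleleft> \<alpha>\<^bsub>L\<^esub> z \<oplus> h [\<langle>x, y\<rangle>\<^bsub>L\<^esub>, \<alpha>\<^bsub>L\<^esub> z] \<oplus>
          \<alpha>\<^bsub>L\<^esub> y \<triangleright> h [x, z] \<oplus> h [\<alpha>\<^bsub>L\<^esub> y, \<langle>x, z\<rangle>\<^bsub>L\<^esub>]) \<oplus>
        (\<langle>x, y\<rangle>\<^bsub>L\<^esub> \<triangleright> \<alpha> p \<oplus> \<alpha>\<^bsub>L\<^esub> y \<triangleright> (x \<triangleright> p)) \<oplus>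
        ((x \<triangleright> n) \<triangleleft> \<alpha>\<^bsub>L\<^esub> z \<oplus> \<alpha> n \<triangleleft> \<langle>x, z\<rangle>\<^bsub>L\<^esub>) \<oplus>
        ((m \<triangleleft> y) \<triangleleft> \<alpha>\<^bsub>L\<^esub> z \<oplus> \<alpha>\<^bsub>L\<^esub> y \<triangleright> (m \<triangleleft> z))"
      using xm by (simp only: cocycle_eq[of x y z] rep_LLM[of x y p] rep_LML[of x z n] rep_MLL[of y z m])
    also have "\<dots> =
        (h [\<langle>x, y\<rangle>\<^bsub>L\<^esub>, \<alpha>\<^bsub>L\<^esub> z] \<oplus> \<langle>x, y\<rangle>\<^bsub>L\<^esub> \<triangleright> \<alpha> p \<oplus> (h [x, y] \<oplus> x \<triangleright> n \<oplus> m \<triangleleft> y) \<triangleleft> \<alpha>\<^bsub>L\<^esub> z) \<oplus>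
        (h [\<alpha>\<^bsub>L\<^esub> y, \<langle>x, z\<rangle>\<^bsub>L\<^esub>] \<oplus> \<alpha>\<^bsub>L\<^esub> y \<triangleright> (h [x, z] \<oplus> x \<triangleright> p \<oplus> m \<triangleleft> z) \<oplus> \<alpha> n \<triangleleft> \<langle>x, z\<rangle>\<^bsub>L\<^esub>)"
      using xm by (simp add: lact_add_right ract_add_left M.V.a_ac)
    finally show ?thesis
      using xm L.hom_leibniz[of x y z] by (simp add: total_simps)
  qed
  show "\<alpha>\<^bsub>P\<^esub> \<langle>u, v\<rangle>\<^bsub>P\<^esub> = \<langle>\<alpha>\<^bsub>P\<^esub> u, \<alpha>\<^bsub>P\<^esub> v\<rangle>\<^bsub>P\<^esub>"
    if "u \<in> carrier P" "v \<in> carrier P" for u v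
    using that by (auto simp: total_simps L.twist_bracket twist M.twist_add twist_lact twist_ract)
  \<comment> \<open>In the second component \<open>h\<close> and the right action contribute the
    factor \<phi> f alone; the anchor term comes from the left action on a multiple of an element of
    M. For multiples in the first argument the two actions exchange their roles.\<close>
  show "\<langle>u, f \<odot>\<^bsub>P\<^esub> v\<rangle>\<^bsub>P\<^esub> =
      \<phi> f \<odot>\<^bsub>P\<^esub> \<langle>u, v\<rangle>\<^bsub>P\<^esub> \<oplus>\<^bsub>P\<^esub> lanchor P u f \<odot>\<^bsub>P\<^esub> \<alpha>\<^bsub>P\<^esub> v"
    if "u \<in> carrier P" "v \<in> carrier P" "f \<in> carrier A" for u v f
    using that
    by (auto simp: total_simps room_eq_iff L.bracket_smult_right smult_right lact_smult ract_smult
        M.V.smult_r_distr M.V.a_ac)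
  show "\<langle>f \<odot>\<^bsub>P\<^esub> u, v\<rangle>\<^bsub>P\<^esub> =
      \<phi> f \<odot>\<^bsub>P\<^esub> \<langle>u, v\<rangle>\<^bsub>P\<^esub> \<ominus>\<^bsub>P\<^esub> ranchor P v f \<odot>\<^bsub>P\<^esub> \<alpha>\<^bsub>P\<^esub> u"
    if "u \<in> carrier P" "v \<in> carrier P" "f \<in> carrier A" for u v f
    using that
    by (auto simp: total_simps total_minus room_eq_iff L.bracket_smult_left smult_left smult_lact
        smult_ract M.V.smult_r_distr a_minus_def[of M] M.V.a_ac)
\<comment> \<open>The remaining axioms concern the anchors, which read the first component only, and
  so reduce to those of L.\<close>
qed (elim totalE; simp add: total_simps total_scal L.lanchor_der L.ranchor_der L.lanchor_add L.ranchor_add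
    L.lanchor_scal L.ranchor_scal L.lanchor_twist L.ranchor_twist L.ranchor_ranchor
    L.lanchor_bracket L.ranchor_bracket L.lanchor_smult L.ranchor_smult)+

lemma abelian_extension: "abelian_extension K A \<phi> L M E"
  unfolding abelian_extension_def
proof (intro conjI ballI)
  show "hom_leibniz_rinehart K A \<phi> P"
    by (rule total_hlr)
  show "hlr_map A P L (proj E)"
    by (auto simp: hlr_map_def hom_module_map_def A_linear_def additive_map_def total_simps)
  show "hom_module_map A M P (incl E)"
    by (auto simp: hom_module_map_def A_linear_def additive_map_def total_simps)
  show "inj_on (incl E) (carrier M)"
    by (auto simp: inj_on_def total_simps room_eq_iff)
  show "incl E ` carrier M = {u \<in> carrier P. proj E u = \<zero>\<^bsub>L\<^esub>}"
    by (auto simp: total_simps image_iff)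
  show "proj E ` carrier P = carrier L"
  proof (intro equalityI subsetI)
    show "x \<in> proj E ` carrier P" if "x \<in> carrier L" for x
      using that by (intro image_eqI[of _ _ "room (x, \<zero>)"]) (auto simp: total_simps)
  qed (auto simp: total_simps)
qed (auto simp: total_simps L.bracket_zero)

lemma splitting: "splitting A L E (\<lambda>x. room (x, \<zero>))"
  by (auto simp: splitting_def hom_module_map_def A_linear_def additive_map_def total_simps)

text \<open>On pairs with second component zero both action terms vanish and the bracket leaves
  \<open>h\<close>. Thus every cocycle is a factor set, which gives surjectivity.\<close>

lemma factor_set: "factor_set L M E (\<lambda>x. room (x, \<zero>)) = h"
proof -
  interpret S: split_extension K A \<phi> L M E "\<lambda>x. room (x, \<zero>)"
    using abelian_extension splitting by unfold_locales
  show ?thesis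
  proof (rule S.factor_set_eqI)
    show "h \<in> extensional (tuples L 2)"
      using cochain by (auto simp: cochains_2_iff PiE_iff)
    show "\<langle>room (x, \<zero>), room (y, \<zero>)\<rangle>\<^bsub>P\<^esub> = S.coord \<langle>x, y\<rangle>\<^bsub>L\<^esub> (h [x, y])"
      if "x \<in> carrier L" "y \<in> carrier L" for x y
      using that by (simp add: S.coord_def total_simps)
  qed simp
qed

end

section \<open>Passage to equivalence classes\<close>

text \<open>A map is constant on the classes of its kernel, so its value at a chosen representative
  does not depend on the choice, and distinct classes have distinct values.\<close>

lemma bij_betw_kernel_quotient:
  assumes "R = {(x, y). x \<in> S \<and> y \<in> S \<and> f x = f y}"
  shows "bij_betw (\<lambda>C. f (SOME x. x \<in> C)) (S // R) (f ` S)"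
proof -
  have eq: "f (SOME y. y \<in> R `` {x}) = f x" if "x \<in> S" for x
    using someI[of "\<lambda>y. y \<in> R `` {x}" x] that assms by auto
  have quotient: "S // R = (\<lambda>x. R `` {x}) ` S"
    by (auto simp: quotient_def)
  have same: "R `` {x} = R `` {y}" if "x \<in> S" "y \<in> S" "f x = f y" for x y
    using that assms by auto
  show ?thesis
    unfolding quotient
  proof (rule bij_betw_imageI)
    show "inj_on (\<lambda>C. f (SOME x. x \<in> C)) ((\<lambda>x. R `` {x}) ` S)"
    proof (rule inj_onI)
      fix C D
      assume "C \<in> (\<lambda>x. R `` {x}) ` S" "D \<in> (\<lambda>x. R `` {x}) ` S"
        and f: "f (SOME x. x \<in> C) = f (SOME x. x \<in> D)"
      then obtain x y where "x \<in> S" "C = R `` {x}" "y \<in> S" "D = R `` {y}"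
        by blast
      then show "C = D"
        using f eq same by metis
    qed
    show "(\<lambda>C. f (SOME x. x \<in> C)) ` (\<lambda>x. R `` {x}) ` S = f ` S"
      unfolding image_image by (rule image_cong[OF refl eq])
  qed
qed

theorem theorem5p6:
  fixes K :: "'k ring" and A :: "('k, 'a) module" and \<phi> :: "'a \<Rightarrow> 'a"
    and L :: "('a, 'l) hlr" and M :: "('a, 'l, 'm) hlr_rep"
    and room :: "'l \<times> 'm \<Rightarrow> 'e"
  assumes "twisted_algebra K A \<phi>"
    and "hom_leibniz_rinehart K A \<phi> L"
    and "hlr_representation K A \<phi> L M"
    and "inj_on room (carrier L \<times> carrier M)"
  shows "\<exists>F. bij_betw F (A_split_extension_classes TYPE('e) K A \<phi> L M) (carrier (H2 A \<phi> L M))"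
proof -
  let ?S = "A_split_extensions K A \<phi> L M :: ('a, 'l, 'm, 'e) extension set"
  let ?c = "extension_class A L M :: ('a, 'l, 'm, 'e) extension \<Rightarrow> _"
  let ?coset = "\<lambda>h. coboundary L M 1 ` cochains A \<phi> L M 1 #>\<^bsub>cochain_group A \<phi> L M 2\<^esub> h"
  have split: "split_extension K A \<phi> L M E \<tau>"
    if "E \<in> ?S" "splitting A L E \<tau>" for E \<tau>
    using that assms(3)
    by (simp add: split_extension_def split_extension_axioms_def A_split_extensions_def)
  have splitting: "\<exists>\<tau>. splitting A L E \<tau>" if "E \<in> ?S" for E
    using that by (auto simp: A_split_extensions_def A_split_def splitting_def)
  \<comment> \<open>Left to right this is injectivity of the correspondence, right to left it is
    well-definedness.\<close>
  have "?c E = ?c E' \<longleftrightarrow> equivalent_extensions A M E E'" if E: "E \<in> ?S" and E': "E' \<in> ?S" for E E'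
  proof
    assume eq: "?c E = ?c E'"
    obtain \<tau> where \<tau>: "splitting A L E \<tau>"
      using splitting[OF E] by blast
    \<comment> \<open>Equal classes share this element, so some splitting of \<open>E'\<close> has
      the same factor set as \<open>\<tau>\<close>.\<close>
    then have "factor_set L M E \<tau> \<in> ?c E'"
      using eq by (auto simp: extension_class_def)
    then obtain \<tau>' where "splitting A L E' \<tau>'" "factor_set L M E \<tau> = factor_set L M E' \<tau>'"
      by (auto simp: extension_class_def)
    then show "equivalent_extensions A M E E'"
      using split[OF E \<tau>] split[OF E'] equivalent_extensionsI by blast
  next
    assume "equivalent_extensions A M E E'"
    then obtain \<Phi> where \<Phi>: "hlr_map A (total E) (total E') \<Phi>"
      "\<And>m. m \<in> carrier M \<Longrightarrow> \<Phi> (incl E m) = incl E' m"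
      "\<And>e. e \<in> carrier (total E) \<Longrightarrow> proj E' (\<Phi> e) = proj E e"
      unfolding equivalent_extensions_def by blast
    obtain \<tau> where "splitting A L E \<tau>"
      using splitting[OF E] by blast
    then interpret S: split_extension K A \<phi> L M E \<tau>
      by (rule split[OF E])
    have "abelian_extension K A \<phi> L M E'"
      using E' by (simp add: A_split_extensions_def)
    note \<tau>' = S.equivalent_factor_set[OF this \<Phi>]
    interpret S': split_extension K A \<phi> L M E' "\<Phi> \<circ> \<tau>"
      by (rule split[OF E' \<tau>'(1)])
    show "?c E = ?c E'"
      \<comment> \<open>Both classes are cosets of the coboundaries with the same
        representative.\<close>
      by (simp only: S.extension_class_eq S'.extension_class_eq \<tau>'(2))
  qed
  then have "extension_equivalence K A \<phi> L M = {(E, E'). E \<in> ?S \<and> E' \<in> ?S \<and> ?c E = ?c E'}"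
    unfolding extension_equivalence_def by blast
  then have "bij_betw (\<lambda>C. ?c (SOME E. E \<in> C)) (A_split_extension_classes TYPE('e) K A \<phi> L M) (?c ` ?S)"
    unfolding A_split_extension_classes_def by (rule bij_betw_kernel_quotient)
  moreover have "?c ` ?S = ?coset ` cocycles A \<phi> L M 2"
  proof (intro equalityI subsetI)
    fix C assume "C \<in> ?c ` ?S"
    then obtain E where E: "E \<in> ?S" "C = ?c E" by blast
    obtain \<tau> where "splitting A L E \<tau>"
      using splitting[OF E(1)] by blast
    then interpret S: split_extension K A \<phi> L M E \<tau>
      by (rule split[OF E(1)])
    show "C \<in> ?coset ` cocycles A \<phi> L M 2"
      unfolding E(2) S.extension_class_eq using S.factor_set_cocycle by (rule imageI)
  next
    fix C assume "C \<in> ?coset ` cocycles A \<phi> L M 2"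
    then obtain h where h: "h \<in> cocycles A \<phi> L M 2" "C = ?coset h" by blast
    interpret Z: cocycle K A \<phi> L M h room
      using assms(3,4) h(1) by (simp add: cocycle_def cocycle_axioms_def)
    have E: "Z.E \<in> ?S"
      using Z.abelian_extension Z.splitting
      by (auto simp: A_split_extensions_def A_split_def splitting_def)
    interpret S: split_extension K A \<phi> L M Z.E "\<lambda>x. room (x, \<zero>\<^bsub>M\<^esub>)"
      by (rule split[OF E Z.splitting])
    have "C = ?c Z.E"
      by (simp only: h(2) S.extension_class_eq Z.factor_set)
    then show "C \<in> ?c ` ?S" using E by blast
  qed
  \<comment> \<open>A coset depends on the multiplication only; shrinking the carrier to the
    cocycles just limits the representatives.\<close>
  moreover have "carrier (H2 A \<phi> L M) = ?coset ` cocycles A \<phi> L M 2"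
    by (auto simp: H2_def FactGroup_def RCOSETS_def)
  ultimately show ?thesis by metis
qed

end
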